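(* For all weak compositions $\alpha$ and $\beta$, the renormalized monomial quasisymmetric functions satisfy $$M_\alpha M_\beta=M_{\alpha*\beta},$$ where $*$ is the quasi-shuffle product of weak compositions and $M$ is extended linearly. Consequently, the set $\mathrm{RenQSym}$ of all $\mathbf k$-linear combinations of renormalized monomial quasisymmetric functions is a subalgebra of $\mathbf k[[X]][t]$.
   Context: $\mathbf k$ is a commutative ring containing $\mathbb Q$. $\mathbb P$ and $\mathbb N$ denote the positive and nonnegative integers. A weak composition is a finite sequence of nonnegative integers, possibly empty. Let $X=\{x_i:i\in\mathbb P\}$ be commuting indeterminates. Quasi-shuffle of weak compositions. $\emptyset$ is the unit, and $$a*b=(a_1,(a_2,\dots,a_m)*b)+(b_1,a*(b_2,\dots,b_n))+(a_1+b_1,(a_2,\dots,a_m)*(b_2,\dots,b_n)),$$ with $(c,\sum\lambda_uu)=\sum\lambda_u(c,u)$. The same rule, with columns added componentwise, defines the quasi-shuffle product on matrices $\binom{\alpha}{\beta}$ with $\alpha\in\mathbb N^k$, $\beta\in\mathbb P^k$. GSym. $\mathrm{GSym}\subseteq\mathbb Q[[X]]$ is the $\mathbb Q$-span of $\widehat M_{\binom{\gamma}{\mu}}=\sum_{0<i_1<\cdots<i_r}i_1^{\mu_1}\cdots i_r^{\mu_r}x_{i_1}^{\gamma_1}\cdots x_{i_r}^{\gamma_r}$, for $\gamma\in\mathbb N^r$ with $r=0$ or $\gamma_r>0$, and $\mu\in\mathbb N^r$. Regularization. For $\alpha\in\mathbb N^k$, $\beta\in\mathbb P^k$, $\phi\binom{\alpha}{\beta}\in\mathrm{GSym}[t][z^{-1},z]]$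 is obtained from $\sum_{0<i_1<\cdots<i_k}\prod_l x_{i_l}^{\alpha_l}e^{(i_l+t)\beta_lz}$. The coefficient of each $X$-monomial converges absolutely for $t\ge0$, $\mathrm{Re}(z)<0$; it is expanded as a Laurent series in $z$ with coefficients in $\mathbb Q[t]$, and powers are collected. Renormalization. Let $P$ be the polar-part projection in $z$. Set $\phi_-(\emptyset)=1$ and $$\phi_\mp\tbinom{\alpha}{\beta}=\{-P,\ \mathrm{id}-P\}\Big(\phi\tbinom{\alpha}{\beta}+\sum_{i=1}^{k-1}\phi\tbinom{\alpha_1..\alpha_i}{\beta_1..\beta_i}\phi_-\tbinom{\alpha_{i+1}..\alpha_k}{\beta_{i+1}..\beta_k}\Big),$$ i.e. $\phi_-$ uses $-P$ and $\phi_+$ uses $\mathrm{id}-P$. Put $Z\binom{\alpha}{\beta}=\phi_+\binom{\alpha}{\beta}|_{z=0}\in\mathrm{GSym}[t]$. Renormalized monomial quasisymmetric functions. For a weak composition $\alpha$ of length $k$, $M_\alpha:=Z\binom{\alpha}{\delta,\dots,\delta}$ for $\delta\in\mathbb P$; this does not depend on $\delta$. Also $M_\emptyset=1$. When the last entry of $\alpha$ is positive, $M_\alpha=\sum_{0<i_1<\cdots<i_k}x_{i_1}^{\alpha_1}\cdots x_{i_k}^{\alpha_k}$. *)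

theory Defs
  imports "HOL-Complex_Analysis.Complex_Analysis" "HOL-Library.Poly_Mapping"
    "HOL-Library.Multiset" "HOL-Computational_Algebra.Polynomial"
    "HOL-Computational_Algebra.Formal_Laurent_Series"
begin

text \<open>An X-monomial is a finitely supported exponent vector; a formal power series in X
  with coefficients in a ring A is a function from monomials to A.\<close>

type_synonym xmono = "nat \<Rightarrow>\<^sub>0 nat"
type_synonym 'a xser = "xmono \<Rightarrow> 'a"

definition xmul :: "'a::comm_ring_1 xser \<Rightarrow> 'a xser \<Rightarrow> 'a xser" where
  "xmul f g = (\<lambda>m. \<Sum>(a, b) \<in> {(a, b). a + b = m}. f a * g b)"

definition xone :: "'a::comm_ring_1 xser" where
  "xone = (\<lambda>m. if m = 0 then 1 else 0)"

section \<open>Quasi-shuffle of weak compositions (formal N-linear combination = multiset)\<close>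

fun qsh :: "nat list \<Rightarrow> nat list \<Rightarrow> nat list multiset" where
  "qsh [] b = {#b#}"
| "qsh a [] = {#a#}"
| "qsh (x # a) (y # b) =
     image_mset (Cons x) (qsh a (y # b)) + image_mset (Cons y) (qsh (x # a) b)
     + image_mset (Cons (x + y)) (qsh a b)"

text \<open>A matrix (alpha over beta) of length k is a list of k columns (alpha_l, beta_l).\<close>

definition mono_of :: "nat list \<Rightarrow> nat list \<Rightarrow> xmono" where
  "mono_of i a = (\<Sum>l<length i. Poly_Mapping.single (i ! l) (a ! l))"

definition idx_set :: "(nat \<times> nat) list \<Rightarrow> xmono \<Rightarrow> nat list set" where
  "idx_set w m = {i. length i = length w \<and> sorted_wrt (<) i \<and> (\<forall>j\<in>set i. 0 < j)
                     \<and> mono_of i (map fst w) = m}"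

text \<open>Coefficient of the monomial m in the sum of prod_l x^alpha_l e^((i_l+t) beta_l z).\<close>
definition phi_fun :: "(nat \<times> nat) list \<Rightarrow> xmono \<Rightarrow> real \<Rightarrow> complex \<Rightarrow> complex" where
  "phi_fun w m t z = (\<Sum>\<^sub>\<infinity> i \<in> idx_set w m.
      exp (z * (\<Sum>l<length w. (of_nat (i ! l) + complex_of_real t) * of_nat (snd (w ! l)))))"

definition eval_t :: "rat poly fls \<Rightarrow> real \<Rightarrow> complex fls" where
  "eval_t F t = Abs_fls (\<lambda>n. poly (map_poly of_rat (fls_nth F n)) (complex_of_real t))"

definition laurent_left :: "complex fls \<Rightarrow> (complex \<Rightarrow> complex) \<Rightarrow> bool" where
  "laurent_left F f \<longleftrightarrow> fls_conv_radius F > 0 \<and>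
      eventually (\<lambda>z. f z = eval_fls F z) (at 0 within {z. Re z < 0})"

definition phi :: "(nat \<times> nat) list \<Rightarrow> rat poly fls xser" where
  "phi w m = (THE F. \<forall>t\<ge>0. laurent_left (eval_t F t) (phi_fun w m t))"

definition polP :: "rat poly fls \<Rightarrow> rat poly fls" where
  "polP F = F - fps_to_fls (fls_regpart F)"

function phi_minus :: "(nat \<times> nat) list \<Rightarrow> rat poly fls xser" where
  "phi_minus w = (if w = [] then xone else
     (\<lambda>m. - polP (phi w m +
        (\<Sum>i\<in>{1..<length w}. xmul (phi (take i w)) (phi_minus (drop i w)) m))))"
  by pat_completeness auto
termination by (relation "Wellfounded.measure length") auto

definition phi_plus :: "(nat \<times> nat) list \<Rightarrow> rat poly fls xser" where
  "phi_plus w = (\<lambda>m. (phi w m +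
        (\<Sum>i\<in>{1..<length w}. xmul (phi (take i w)) (phi_minus (drop i w)) m))
      - polP (phi w m +
        (\<Sum>i\<in>{1..<length w}. xmul (phi (take i w)) (phi_minus (drop i w)) m)))"

definition Zren :: "(nat \<times> nat) list \<Rightarrow> rat poly xser" where
  "Zren w = (\<lambda>m. fls_nth (phi_plus w m) 0)"

text \<open>Renormalized monomial quasisymmetric function, with rational coefficients
  (taking delta = 1 in the bottom row).\<close>
definition Mq :: "nat list \<Rightarrow> rat poly xser" where
  "Mq a = (if a = [] then xone else Zren (map (\<lambda>x. (x, 1)) a))"

section \<open>Scalars in a commutative ring k containing Q\<close>

definition ratk :: "rat \<Rightarrow> 'k::comm_ring_1" where
  "ratk q = (case quotient_of q of (a, b) \<Rightarrow> of_int a * (SOME y. of_int b * y = 1))"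

definition Mk :: "nat list \<Rightarrow> 'k::comm_ring_1 poly xser" where
  "Mk a = (\<lambda>m. map_poly ratk (Mq a m))"

definition RenQSym :: "'k::comm_ring_1 poly xser set" where
  "RenQSym = {f. \<exists>S c. finite S \<and> f = (\<lambda>m. \<Sum>g\<in>S. smult (c g) (Mk g m))}"

end

theory Submission
  imports Defs
begin

text \<open>
  Only words with bottom row \<open>(1, \<dots>, 1)\<close> matter. Write a weak composition as \<open>u 0\<^sup>k\<close>, where \<open>u\<close> is
  empty or ends in a positive entry. In the coefficient of a fixed monomial the indices belonging to
  \<open>u\<close> run over a finite set, and for last such index \<open>n\<close> the trailing zeros contribute the
  coefficient of \<open>y\<^sup>k\<close> in \<open>\<Prod>\<^sub>i\<^sub>>\<^sub>n (1 + y exp((i + t) z))\<close>. By Newton's identities this product has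
  logarithm \<open>\<Sum>\<^sub>r (-1)^(r-1) (y^r / r) (- 1 / (r z) - (t + n + 1/2) + O(z))\<close>, whose polar part depends
  neither on \<open>t\<close> nor on \<open>n\<close>. Hence the counterterms are supported on the words \<open>0\<^sup>k\<close>, and
  renormalization replaces the product by \<open>(1 + y) powr -(t + n + 1/2)\<close>.

  So a coefficient of \<open>M\<^sub>\<alpha>\<close> is a polynomial in \<open>t\<close> whose value at \<open>t = -N - 1/2\<close>, for every large
  integer \<open>N\<close>, is the corresponding coefficient of the finite sum with all indices bounded by \<open>N\<close>.
  Those finite sums satisfy the quasi-shuffle relations, and polynomials that agree at infinitely
  many points are equal.
\<close>

section \<open>Coefficientwise images of Laurent series\<close>

text \<open>The coefficient function is a Laurent series once \<open>h 0 = 0\<close>, which keeps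
  its support bounded below. All uses have \<open>h\<close> a ring homomorphism.\<close>

definition fls_map :: "('a::zero \<Rightarrow> 'b::zero) \<Rightarrow> 'a fls \<Rightarrow> 'b fls" where
  "fls_map h F = Abs_fls (\<lambda>n. h (fls_nth F n))"

lemma fls_map_nth: "h 0 = 0 \<Longrightarrow> fls_nth (fls_map h F) n = h (fls_nth F n)"
  unfolding fls_map_def
  by (rule nth_Abs_fls_lower_bound[of "fls_subdegree F"]) auto

text \<open>Enlarging the convolution window only adds zero terms. This lets a product and the
  product of the images be summed over the same window, although \<open>h\<close> may change the
  subdegrees.\<close>

lemma fls_times_nth_extend:
  fixes f g :: "'a::semiring_0 fls"
  assumes "df \<le> fls_subdegree f" "dg \<le> fls_subdegree g"
  shows "fls_nth (f * g) n = (\<Sum>i=df..n - dg. fls_nth f i * fls_nth g (n - i))"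
  unfolding fls_times_nth(2)
  by (rule sum.mono_neutral_left) (use assms in \<open>auto simp: not_le\<close>)

text \<open>The instances used are constants into polynomials, \<open>of_rat\<close>, evaluation at
  a value of t, \<open>ratk\<close>, and coefficientwise extensions of these.\<close>

locale coeff_hom =
  fixes h :: "'a::comm_ring_1 \<Rightarrow> 'b::comm_ring_1"
  assumes add: "h (x + y) = h x + h y" and mult: "h (x * y) = h x * h y" and one: "h 1 = 1"
begin

lemma zero: "h 0 = 0"
  using add[of 0 0] by simp

lemma uminus: "h (- x) = - h x"
  using add[of x "- x"] zero by (simp add: eq_neg_iff_add_eq_0 add.commute)

lemma diff: "h (x - y) = h x - h y"
  using add[of x "- y"] uminus by simp

lemma sum: "h (sum f A) = (\<Sum>x\<in>A. h (f x))"
  by (induction A rule: infinite_finite_induct) (auto simp: zero add)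

lemma power: "h (x ^ n) = h x ^ n"
  by (induction n) (auto simp: one mult)

lemma prod: "h (prod f A) = (\<Prod>x\<in>A. h (f x))"
  by (induction A rule: infinite_finite_induct) (auto simp: one mult)

lemma of_nat: "h (of_nat n) = of_nat n"
  by (induction n) (auto simp: zero one add)

lemmas nth = fls_map_nth[of h, OF zero]

text \<open>The minimum with 0 covers the case where \<open>h\<close> kills all coefficients: the
  zero series has subdegree 0 by convention.\<close>

lemma subdegree_ge: "fls_subdegree (fls_map h F) \<ge> min (fls_subdegree F) 0"
proof (cases "fls_map h F = 0")
  case False
  thus ?thesis
    by (intro fls_subdegree_geI) (auto simp: nth zero)
qed auto

lemma coeff_hom_fls_map: "coeff_hom (fls_map h)"
proof
  fix F G :: "'a fls"
  show "fls_map h (F + G) = fls_map h F + fls_map h G"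
    by (intro fls_eqI) (simp add: nth add)
  show "fls_map h (F * G) = fls_map h F * fls_map h G"
  proof (intro fls_eqI)
    fix n
    define df where "df = min (fls_subdegree F) 0"
    define dg where "dg = min (fls_subdegree G) 0"
    show "fls_nth (fls_map h (F * G)) n = fls_nth (fls_map h F * fls_map h G) n"
      using subdegree_ge[of F] subdegree_ge[of G]
      by (simp add: nth fls_times_nth_extend[of df _ dg] df_def dg_def sum mult)
  qed
  show "fls_map h 1 = (1::'b fls)"
    by (intro fls_eqI) (auto simp: nth one zero)
qed

lemma fls_map_fps_to_fls:
  "fls_map h (fps_to_fls f) = fps_to_fls (Abs_fps (\<lambda>n. h (fps_nth f n)))"
  by (intro fls_eqI) (auto simp: nth zero)

lemma coeff_hom_map_poly: "coeff_hom (map_poly h)"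
proof
  fix p q :: "'a poly"
  show "map_poly h (p + q) = map_poly h p + map_poly h q"
    by (intro poly_eqI) (simp add: coeff_map_poly zero add)
  show "map_poly h (p * q) = map_poly h p * map_poly h q"
    by (intro poly_eqI) (simp add: coeff_map_poly zero coeff_mult sum mult)
  show "map_poly h 1 = 1"
    by (simp add: one map_poly_1')
qed

end

lemma coeff_hom_divide:
  fixes h :: "'a::field \<Rightarrow> 'b::field"
  assumes "coeff_hom h" "y \<noteq> 0"
  shows "h (x / y) = h x / h y"
proof -
  interpret coeff_hom h by fact
  have "h (x / y) * h y = h x" and "h y * h (inverse y) = 1"
    using assms(2) by (simp_all flip: mult add: one)
  thus ?thesis by (metis nonzero_eq_divide_eq mult_zero_left zero_neq_one)
qed

section \<open>Newton's identities for a geometric sequence of variables\<close>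

definition qpow :: "nat \<Rightarrow> 'a::field \<Rightarrow> 'a" where
  "qpow r q = q ^ r / (1 - q ^ r)"

definition qelem :: "nat \<Rightarrow> 'a::field \<Rightarrow> 'a" where
  "qelem k q = (\<Prod>j=1..k. qpow j q)"

text \<open>With \<open>q\<close> of modulus less than one, these are the power sums and the elementary symmetric
  functions of \<open>q, q\<^sup>2, q\<^sup>3, \<dots>\<close>. Both sides of Newton's identity solve the functional equation
  \<open>W(y) = (1 + q y) W(q y) + q y U(q y)\<close>, where \<open>U\<close> is the generating function of the elementary
  symmetric functions, and its solution with vanishing constant term is unique.\<close>

lemma qelem_newton:
  fixes q :: "'a::field"
  assumes q: "\<And>j. j > 0 \<Longrightarrow> q ^ j \<noteq> 1"
  defines "U \<equiv> Abs_fps (\<lambda>k. qelem k q)"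
    and "S \<equiv> Abs_fps (\<lambda>r. if r = 0 then 0 else (-1) ^ (r - 1) * qpow r q)"
  shows "fps_X * fps_deriv U = S * U"
proof -
  \<comment> \<open>\<open>sc\<close> substitutes q y for y; the series q y itself is called
    \<open>c\<close> below.\<close>
  define sc where "sc = (\<lambda>f :: 'a fps. fps_compose f (fps_const q * fps_X))"
  have sc_nth: "fps_nth (sc f) n = q ^ n * fps_nth f n" for f n
    by (simp add: sc_def)
  have sc_mult: "sc (f * g) = sc f * sc g" for f g
    unfolding sc_def by (rule fps_compose_mult_distrib) simp
  define c where "c = fps_const q * fps_X"
  have c_nth: "fps_nth (c * f) n = (if n = 0 then 0 else q * fps_nth f (n - 1))" for f n
    by (simp add: c_def mult.assoc)
  have p: "qpow (Suc k) q = q ^ Suc k * qpow (Suc k) q + q ^ Suc k" for k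
    using q[of "Suc k"] by (simp add: qpow_def field_simps)
  have qelem_Suc: "qelem (Suc k) q = q ^ Suc k * qelem (Suc k) q + q * (q ^ k * qelem k q)" for k
  proof -
    have e: "qelem (Suc k) q = qelem k q * qpow (Suc k) q"
      by (simp add: qelem_def)
    have "qelem (Suc k) q = qelem k q * (q ^ Suc k * qpow (Suc k) q + q ^ Suc k)"
      by (simp only: e flip: p[of k])
    also have "\<dots> = q ^ Suc k * qelem (Suc k) q + q * (q ^ k * qelem k q)"
      by (simp add: e algebra_simps)
    finally show ?thesis .
  qed
  \<comment> \<open>Formally \<open>U\<close> is the product of all 1 + q^i y with i \<ge> 1; the
    factor i = 1 is split off and the others are the substituted product.\<close>
  have U: "U = (1 + c) * sc U"
  proof (intro fps_ext)
    fix n show "fps_nth U n = fps_nth ((1 + c) * sc U) n"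
    proof (cases n)
      case (Suc k)
      show ?thesis using qelem_Suc[of k] by (simp add: Suc U_def sc_nth c_nth distrib_right)
    qed (simp add: U_def sc_nth c_def distrib_right)
  qed
  define L where "L = fps_X * fps_deriv U"
  have L_nth: "fps_nth L n = of_nat n * qelem n q" for n
    by (cases n) (simp_all add: L_def U_def)
  \<comment> \<open>This is y d/dy of the previous equation; the operator commutes with
    \<open>sc\<close> and fixes \<open>c\<close>.\<close>
  have L: "L = c * sc U + (1 + c) * sc L"
  proof (intro fps_ext)
    fix n show "fps_nth L n = fps_nth (c * sc U + (1 + c) * sc L) n"
    proof (cases n)
      case (Suc k)
      have "fps_nth L n = of_nat (Suc k) * (q ^ Suc k * qelem (Suc k) q + q * (q ^ k * qelem k q))"
        using qelem_Suc[of k] Suc by (simp add: L_nth)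
      also have "\<dots> = fps_nth (c * sc U + (1 + c) * sc L) n"
        by (simp add: Suc U_def sc_nth c_nth distrib_right L_nth algebra_simps)
      finally show ?thesis .
    qed (simp add: L_nth sc_nth c_def distrib_right)
  qed
  \<comment> \<open>The variable q contributes q y / (1 + q y) to the alternating power sum series;
    multiplying by \<open>1 + c\<close> avoids the division.\<close>
  have S: "(1 + c) * S = (1 + c) * sc S + c"
  proof (intro fps_ext)
    fix n
    have p': "qpow (Suc k) q - q ^ Suc k * qpow (Suc k) q = q ^ Suc k" for k
      using p[of k] by (metis add_diff_cancel_left')
    have S_diff: "fps_nth S n - fps_nth (sc S) n = (if n = 0 then 0 else (-1) ^ (n - 1) * q ^ n)" for n
    proof (cases n)
      case (Suc k)
      have "fps_nth S n - fps_nth (sc S) n = (-1) ^ k * (qpow (Suc k) q - q ^ Suc k * qpow (Suc k) q)"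
        by (simp add: Suc S_def sc_nth algebra_simps)
      thus ?thesis by (simp only: Suc p') simp
    qed (simp add: S_def sc_nth)
    have "fps_nth ((1 + c) * S - (1 + c) * sc S) n
        = (fps_nth S n - fps_nth (sc S) n)
          + (if n = 0 then 0 else q * (fps_nth S (n - 1) - fps_nth (sc S) (n - 1)))"
      by (simp add: distrib_right c_nth right_diff_distrib)
    also have "\<dots> = fps_nth c n"
    proof (cases n)
      case (Suc k)
      show ?thesis unfolding S_diff
        by (cases k) (simp_all add: Suc c_def)
    qed (simp add: S_diff c_def)
    finally show "fps_nth ((1 + c) * S) n = fps_nth ((1 + c) * sc S + c) n"
      by (simp add: algebra_simps)
  qed
  define W where "W = L - S * U"
  have "S * U = (1 + c) * S * sc U"
    by (subst (1) U) (simp add: algebra_simps)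
  also have "\<dots> = (1 + c) * sc (S * U) + c * sc U"
    unfolding S by (simp add: algebra_simps sc_mult)
  finally have "W = (1 + c) * (sc L - sc (S * U))"
    unfolding W_def by (subst L) (simp add: algebra_simps)
  also have "sc L - sc (S * U) = sc W"
    by (simp add: W_def sc_def fps_compose_sub_distrib)
  finally have W: "W = (1 + c) * sc W" .
  \<comment> \<open>Once the preceding coefficient is zero, comparing coefficients leaves W_n = q^n
    W_n, and q^n \<noteq> 1.\<close>
  have "fps_nth W n = 0" for n
  proof (induction n)
    case 0
    show ?case by (simp add: W_def L_def S_def)
  next
    case (Suc n)
    have "fps_nth W (Suc n) = fps_nth ((1 + c) * sc W) (Suc n)"
      using W by simp
    also have "\<dots> = q ^ Suc n * fps_nth W (Suc n)"
      using Suc by (simp add: distrib_right c_nth sc_nth)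
    finally show ?case using q[of "Suc n"] by simp
  qed
  hence "W = 0" by (intro fps_ext) simp
  thus ?thesis by (simp add: W_def L_def)
qed

section \<open>The Birkhoff factorization of the trailing zeros\<close>

abbreviation expz :: "'a::field_char_0 fls" where
  "expz \<equiv> fps_to_fls (fps_exp 1)"

lemma expz_power: "expz ^ r = fps_to_fls (fps_exp (of_nat r))"
  by (simp flip: fps_to_fls_power add: fps_exp_power_mult)

lemma expz_power_neq_1: "r > 0 \<Longrightarrow> (expz :: 'a::field_char_0 fls) ^ r \<noteq> 1"
proof
  assume "r > 0" "(expz :: 'a fls) ^ r = 1"
  hence "fps_nth (fps_exp (of_nat r) :: 'a fps) 1 = fps_nth 1 1"
    by (simp add: expz_power)
  thus False using \<open>r > 0\<close> by simp
qed

text \<open>That is, \<open>exp(r z) / (1 - exp(r z)) = - 1 / (r z) - 1 / 2 + O(z)\<close>.\<close>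

lemma qpow_expz:
  assumes "r > 0"
  obtains A :: "rat fps" where "qpow r expz = fls_X_inv * fps_to_fls A"
    "fps_nth A 0 = - 1 / of_nat r" "fps_nth A 1 = - 1 / 2"
proof -
  define e where "e = (fps_exp (of_nat r) :: rat fps)"
  \<comment> \<open>\<open>1 - e\<close> vanishes at z = 0; dividing it by z leaves an invertible
    series, so \<open>qpow r expz\<close> has a simple pole with numerator \<open>A\<close>.\<close>
  define D where "D = fps_shift 1 (1 - e)"
  define A where "A = e * inverse D"
  have D0: "fps_nth D 0 = - of_nat r" and D1: "fps_nth D 1 = - (of_nat r)\<^sup>2 / 2"
    by (simp_all add: D_def e_def power2_eq_square numeral_2_eq_2)
  have D: "fps_X * D = 1 - e"
    by (intro fps_ext) (auto simp: D_def e_def)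
  have AD: "A * D = e"
    using D0 assms by (simp add: A_def mult.assoc inverse_mult_eq_1)
  have ne: "1 - expz ^ r \<noteq> (0 :: rat fls)"
    using expz_power_neq_1[OF assms] by (metis right_minus_eq)
  have "(1 - expz ^ r) * (fls_X_inv * fps_to_fls A)
      = (fls_X_inv * fls_X) * fps_to_fls (A * D)"
    by (simp add: expz_power flip: e_def D fps_one_to_fls fps_to_fls_minus fls_times_fps_to_fls fps_X_to_fls)
  also have "\<dots> = expz ^ r"
    by (simp add: AD expz_power flip: e_def fls_inverse_X)
  finally have "qpow r expz = fls_X_inv * fps_to_fls A"
    using ne by (simp add: qpow_def divide_eq_eq mult.commute)
  moreover have A0: "fps_nth A 0 = - 1 / of_nat r"
  proof -
    have "fps_nth (A * D) 0 = 1" by (simp add: AD e_def)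
    thus ?thesis using D0 assms by (simp add: field_simps)
  qed
  moreover have "fps_nth A 1 = - 1 / 2"
  proof -
    have "fps_nth (A * D) 1 = of_nat r" by (simp add: AD e_def)
    hence "fps_nth A 0 * fps_nth D 1 + fps_nth A 1 * fps_nth D 0 = of_nat r"
      by (simp add: fps_mult_nth)
    hence "of_nat r / 2 - fps_nth A 1 * of_nat r = of_nat r"
      unfolding A0 D0 D1 using assms by (simp add: power2_eq_square)
    hence "fps_nth A 1 * of_nat r = (- 1 / 2) * of_nat r"
      by linarith
    thus ?thesis using assms by (subst (asm) mult_right_cancel) simp_all
  qed
  ultimately show thesis by (rule that)
qed

text \<open>Embeds series that do not involve t, such as \<open>qelem l expz\<close>, into the
  series with coefficients polynomial in t.\<close>

definition lift :: "rat fls \<Rightarrow> rat poly fls" where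
  "lift = fls_map (\<lambda>c. [:c:])"

lemma coeff_hom_pCons: "coeff_hom (\<lambda>c::rat. [:c:])"
  by standard auto

interpretation lift: coeff_hom lift
  unfolding lift_def by (rule coeff_hom.coeff_hom_fls_map[OF coeff_hom_pCons])

lemma lift_nth: "fls_nth (lift F) n = [:fls_nth F n:]"
  by (simp add: lift_def fls_map_nth)

lemma lift_fps_to_fls: "lift (fps_to_fls f) = fps_to_fls (Abs_fps (\<lambda>n. [:fps_nth f n:]))"
  unfolding lift_def by (rule coeff_hom.fls_map_fps_to_fls[OF coeff_hom_pCons])

lemma lift_X_inv: "lift fls_X_inv = fls_X_inv"
  by (intro fls_eqI) (simp add: lift_nth one_pCons)

text \<open>The series exp (p z) in z, where p is a polynomial in t.\<close>

definition expt :: "rat poly \<Rightarrow> rat poly fps" where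
  "expt p = Abs_fps (\<lambda>n. smult (1 / fact n) (p ^ n))"

lemma expt_power_nth:
  "fps_nth (expt p ^ r) 0 = 1" "fps_nth (expt p ^ r) 1 = of_nat r * p"
proof -
  show 0: "fps_nth (expt p ^ r) 0 = 1" for r
    by (induction r) (auto simp: expt_def)
  show "fps_nth (expt p ^ r) 1 = of_nat r * p"
    using 0 by (induction r) (simp_all add: fps_mult_nth, simp add: expt_def algebra_simps)
qed

text \<open>The coefficients of \<open>exp (\<Sum>\<^sub>r (-1)^(r-1) y^r / (r\<^sup>2 z))\<close> in \<open>y\<close>, which cancel the poles of
  \<open>\<Prod>\<^sub>i (1 + y exp((i + t) z))\<close>; the recursion is the logarithmic derivative in \<open>y\<close>.\<close>

fun counter :: "nat \<Rightarrow> rat fls" where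
  "counter k = (if k = 0 then 1 else fls_const (1 / of_nat k) *
     (\<Sum>r\<in>{1..k}. fls_const ((-1) ^ (r - 1) / of_nat r) * fls_X_inv * counter (k - r)))"

declare counter.simps [simp del]

lemma counter_0: "counter 0 = 1"
  by (simp add: counter.simps)

lemma counter_rec:
  "of_nat k * counter k
    = (\<Sum>r\<in>{1..k}. fls_const ((-1) ^ (r - 1) / of_nat r) * fls_X_inv * counter (k - r))"
proof (cases "k = 0")
  case False
  have "of_nat k * fls_const (1 / of_nat k :: rat) = 1"
    using False by (simp add: fls_of_nat fls_const_mult_const)
  thus ?thesis using False
    by (subst counter.simps) (simp flip: mult.assoc)
qed simp

text \<open>Every step of the recursion multiplies by 1 / z, so for k > 0 only negative powers occur
  and the counterterm is its own polar part. The case distinction in the bound spares the constant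
  \<open>counter 0 = 1\<close>.\<close>

lemma counter_polar: "n \<ge> (if k = 0 then 1 else 0) \<Longrightarrow> fls_nth (counter k) n = 0"
proof (induction k arbitrary: n rule: less_induct)
  case (less k)
  show ?case
  proof (cases "k = 0")
    case False
    have "fls_nth (fls_X_inv * counter (k - r)) n = 0" if "r \<in> {1..k}" for r
      using that less.IH[of "k - r" "n + 1"] less.prems False
      by (auto simp: fls_X_inv_times_conv_shift split: if_splits)
    thus ?thesis using False
      by (subst counter.simps) (simp add: mult.assoc fls_nth_sum)
  qed (use less.prems in \<open>simp add: counter.simps\<close>)
qed

text \<open>The coefficient of y^k in (1 + y)^N, with N a polynomial in t.\<close>

definition binp :: "rat poly \<Rightarrow> nat \<Rightarrow> rat poly" where
  "binp N k = smult (1 / fact k) (\<Prod>j<k. N - of_nat j)"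

lemma binp_0: "binp N 0 = 1"
  by (simp add: binp_def)

lemma binp_Suc: "of_nat (Suc k) * binp N (Suc k) = (N - of_nat k) * binp N k"
  by (simp add: binp_def of_nat_poly mult.commute flip: of_nat_Suc)

lemma poly_binp: "poly (binp N k) x = poly N x gchoose k"
  by (simp add: binp_def poly_prod gbinomial_prod_rev atLeast0LessThan)

text \<open>The logarithmic derivative y d/dy of (1 + y)^N is N (y - y^2 + y^3 - ...). The constant
  terms of \<open>renz\<close> will satisfy the same recursion.\<close>

lemma binp_rec: "of_nat k * binp N k = (\<Sum>r\<in>{1..k}. (-1) ^ (r - 1) * (N * binp N (k - r)))"
proof (induction k)
  case (Suc k)
  have "(\<Sum>r\<in>{1..Suc k}. (-1) ^ (r - 1) * (N * binp N (Suc k - r)))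
      = N * binp N k + (\<Sum>r\<in>{1..k}. (-1) ^ r * (N * binp N (k - r)))"
    by (subst sum.atLeast_Suc_atMost) (simp_all add: sum.shift_bounds_cl_Suc_ivl del: sum.cl_ivl_Suc)
  also have "(\<Sum>r\<in>{1..k}. (-1) ^ r * (N * binp N (k - r)))
      = - (\<Sum>r\<in>{1..k}. (-1) ^ (r - 1) * (N * binp N (k - r)))"
    unfolding sum_negf [symmetric]
    by (intro sum.cong refl) (simp add: power_eq_if)
  also have "\<dots> = - (of_nat k * binp N k)"
    by (simp only: Suc)
  finally show ?case
    unfolding binp_Suc by (simp add: algebra_simps)
qed simp

lemma degree_binp:
  assumes "degree N \<le> 1"
  shows "degree (binp N k) \<le> k"
proof -
  have "degree (\<Prod>j<k. N - of_nat j) \<le> (\<Sum>j<k. degree (N - of_nat j))"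
    using degree_prod_sum_le[of "{..<k}" "\<lambda>j. N - of_nat j"] by (simp add: o_def)
  also have "\<dots> \<le> (\<Sum>j<k. 1)"
    using assms by (intro sum_mono degree_diff_le) auto
  finally show ?thesis by (simp add: binp_def)
qed

text \<open>The renormalization of the word \<open>0\<^sup>k\<close>, with \<open>t\<close> replaced by \<open>p\<close>.\<close>

definition renz :: "rat poly \<Rightarrow> nat \<Rightarrow> rat poly fls" where
  "renz p k = (\<Sum>l\<le>k. fps_to_fls (expt p) ^ l * lift (qelem l expz) * lift (counter (k - l)))"

lemma fps_nth_X_deriv:
  "fps_nth (fps_X * fps_deriv f) n = of_nat n * fps_nth f n" for f :: "'a::comm_ring_1 fps"
  by (cases n) simp_all

text \<open>The generating function of \<open>renz\<close> in y is a product \<open>F * G\<close>,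
  so the logarithmic derivatives add: Newton's identities supply that of \<open>F\<close>, and
  \<open>counter_rec\<close> that of \<open>G\<close>.\<close>

lemma renz_rec:
  "of_nat k * renz p k = (\<Sum>r\<in>{1..k}. (-1) ^ (r - 1) *
     ((fps_to_fls (expt p) ^ r * lift (qpow r expz) + lift (fls_const (1 / of_nat r) * fls_X_inv))
      * renz p (k - r)))"
proof -
  define e where "e = fps_to_fls (expt p)"
  define a where "a = (\<lambda>r. (-1) ^ (r - 1) * (e ^ r * lift (qpow r expz)))"
  define b where "b = (\<lambda>r. (-1) ^ (r - 1) * lift (fls_const (1 / of_nat r) * fls_X_inv))"
  define A where "A = Abs_fps (\<lambda>r. if r = 0 then 0 else a r)"
  define B where "B = Abs_fps (\<lambda>r. if r = 0 then 0 else b r)"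
  define F where "F = Abs_fps (\<lambda>k. e ^ k * lift (qelem k expz))"
  define G where "G = Abs_fps (\<lambda>k. lift (counter k))"
  have skip0: "(\<Sum>i=0..n. (if i = 0 then 0 else f i) * g i) = (\<Sum>i\<in>{1..n}. f i * g i)"
    for f g :: "nat \<Rightarrow> 'b::comm_ring_1" and n
    by (rule sum.mono_neutral_cong_right) auto
  \<comment> \<open>\<open>F\<close> is the series of \<open>qelem_newton\<close> with y replaced by
    e y, so the r-th coefficient of its logarithmic derivative gains the factor e^r.\<close>
  have F: "fps_X * fps_deriv F = A * F"
  proof (intro fps_ext)
    fix n
    have "fps_X * fps_deriv (Abs_fps (\<lambda>k. qelem k (expz :: rat fls)))
        = Abs_fps (\<lambda>r. if r = 0 then 0 else (-1) ^ (r - 1) * qpow r expz) * Abs_fps (\<lambda>k. qelem k expz)"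
      by (rule qelem_newton) (rule expz_power_neq_1)
    hence "fps_nth (fps_X * fps_deriv (Abs_fps (\<lambda>k. qelem k (expz :: rat fls)))) n
        = (\<Sum>r\<in>{1..n}. (-1) ^ (r - 1) * qpow r expz * qelem (n - r) expz)"
      by (simp only: fps_mult_nth[of "Abs_fps _"] fps_nth_Abs_fps skip0)
    hence "lift (of_nat n * qelem n expz)
        = lift (\<Sum>r\<in>{1..n}. (-1) ^ (r - 1) * qpow r expz * qelem (n - r) expz)"
      by (simp only: fps_nth_X_deriv fps_nth_Abs_fps)
    hence "of_nat n * lift (qelem n expz)
        = (\<Sum>r\<in>{1..n}. (-1) ^ (r - 1) * lift (qpow r expz) * lift (qelem (n - r) expz))"
      by (simp add: lift.mult lift.of_nat lift.sum lift.power lift.uminus lift.one)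
    hence "of_nat n * (e ^ n * lift (qelem n expz))
        = (\<Sum>r\<in>{1..n}. e ^ n * ((-1) ^ (r - 1) * lift (qpow r expz) * lift (qelem (n - r) expz)))"
      by (simp flip: sum_distrib_left add: mult.left_commute)
    also have "\<dots> = (\<Sum>r\<in>{1..n}. a r * (e ^ (n - r) * lift (qelem (n - r) expz)))"
    proof (intro sum.cong refl)
      fix r assume "r \<in> {1..n}"
      hence "e ^ n = e ^ r * e ^ (n - r)" by (simp flip: power_add)
      thus "e ^ n * ((-1) ^ (r - 1) * lift (qpow r expz) * lift (qelem (n - r) expz))
          = a r * (e ^ (n - r) * lift (qelem (n - r) expz))"
        by (simp add: a_def mult_ac)
    qed
    finally show "fps_nth (fps_X * fps_deriv F) n = fps_nth (A * F) n"
      by (simp only: fps_nth_X_deriv fps_mult_nth[of A] F_def) (simp only: A_def fps_nth_Abs_fps skip0)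
  qed
  have G: "fps_X * fps_deriv G = B * G"
  proof (intro fps_ext)
    fix n
    have "lift (of_nat n * counter n) = (\<Sum>r\<in>{1..n}. b r * lift (counter (n - r)))"
    proof -
      have "fls_const ((-1) ^ (r - 1) / of_nat r) = (-1) ^ (r - 1) * fls_const (1 / of_nat r :: rat)" for r
        by (cases "even (r - 1)") (auto simp: fls_eq_iff)
      thus ?thesis
        unfolding counter_rec
        by (simp add: b_def lift.mult lift.sum lift.power lift.uminus lift.one mult_ac)
    qed
    thus "fps_nth (fps_X * fps_deriv G) n = fps_nth (B * G) n"
      by (simp only: fps_nth_X_deriv fps_mult_nth[of B] G_def)
         (simp only: B_def fps_nth_Abs_fps skip0 lift.mult lift.of_nat)
  qed
  have FG: "fps_nth (F * G) n = renz p n" for n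
    by (simp add: F_def G_def fps_mult_nth renz_def e_def atLeast0AtMost)
  have "fps_X * fps_deriv (F * G) = (fps_X * fps_deriv F) * G + F * (fps_X * fps_deriv G)"
    by (simp add: algebra_simps)
  also have "\<dots> = (A + B) * (F * G)"
    by (simp add: F G algebra_simps)
  also have "A + B = Abs_fps (\<lambda>r. if r = 0 then 0 else a r + b r)"
    by (intro fps_ext) (simp add: A_def B_def)
  finally have "fps_nth (fps_X * fps_deriv (F * G)) k
      = fps_nth (Abs_fps (\<lambda>r. if r = 0 then 0 else a r + b r) * (F * G)) k"
    by simp
  hence "of_nat k * renz p k = (\<Sum>r\<in>{1..k}. (a r + b r) * renz p (k - r))"
    by (simp only: fps_nth_X_deriv FG fps_mult_nth[of "Abs_fps _"] fps_nth_Abs_fps skip0)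
  thus ?thesis by (simp add: a_def b_def e_def algebra_simps)
qed

lemma fps_to_fls_sum:
  fixes u :: "'b \<Rightarrow> 'a::comm_ring_1 fps"
  shows "fps_to_fls (sum u X) = (\<Sum>x\<in>X. fps_to_fls (u x))"
  by (induction X rule: infinite_finite_induct) auto

text \<open>In each factor of \<open>renz_rec\<close> the pole - 1 / (r z) cancels against the
  counterterm, and the constant term is - p - 1/2 for every r. Induction then gives regularity, and
  the constant terms obey \<open>binp_rec\<close>.\<close>

lemma renz_regular:
  "\<exists>f. renz p k = fps_to_fls f \<and> fps_nth f 0 = binp (- p - [:1/2:]) k"
proof (induction k rule: less_induct)
  case (less k)
  define N where "N = - p - [:1/2:]"
  show ?case
  proof (cases "k = 0")
    case True
    thus ?thesis
      by (intro exI[of _ 1]) (simp add: renz_def qelem_def counter_0 lift.one binp_0)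
  next
    case False
    have "\<exists>f. (fps_to_fls (expt p) ^ r * lift (qpow r expz)
        + lift (fls_const (1 / of_nat r) * fls_X_inv)) = fps_to_fls f \<and> fps_nth f 0 = N"
      if r: "r \<in> {1..k}" for r
    proof -
      have "r > 0" using r by simp
      then obtain A :: "rat fps" where A: "qpow r expz = fls_X_inv * fps_to_fls A"
        "fps_nth A 0 = - 1 / of_nat r" "fps_nth A 1 = - 1 / 2"
        by (rule qpow_expz)
      define A' where "A' = Abs_fps (\<lambda>n. [:fps_nth A n:])"
      \<comment> \<open>\<open>B\<close> is z times the r-th factor, so coefficient 0 is the residue
        and coefficient 1 the constant term. The latter collects - 1/2 from \<open>A\<close>, and -
        p from r p times - 1 / r.\<close>
      define B where "B = expt p ^ r * A' + fps_const [:1 / of_nat r:]"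
      have "lift (fls_const (1 / of_nat r)) = fls_const [:1 / of_nat r:]"
        by (intro fls_eqI) (simp add: lift_nth)
      hence *: "fps_to_fls (expt p) ^ r * lift (qpow r expz)
          + lift (fls_const (1 / of_nat r) * fls_X_inv) = fls_X_inv * fps_to_fls B"
        by (simp add: A B_def lift.mult lift_X_inv lift_fps_to_fls A'_def fls_times_fps_to_fls
              fps_to_fls_power algebra_simps)
      have B0: "fps_nth B 0 = 0"
        using A(2) by (simp add: B_def A'_def expt_power_nth one_pCons)
      have "fps_nth B 1 = fps_nth (expt p ^ r) 0 * fps_nth A' 1 + fps_nth (expt p ^ r) 1 * fps_nth A' 0"
        by (simp add: B_def fps_mult_nth)
      also have "\<dots> = [:- 1/2:] + of_nat r * p * [:- 1 / of_nat r:]"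
        unfolding expt_power_nth by (simp add: A'_def A(2,3)[simplified])
      also have "\<dots> = N"
        using \<open>r > 0\<close> by (simp add: N_def of_nat_poly)
      finally have B1: "fps_nth B 1 = N" .
      have "fls_X_inv * fps_to_fls B = fps_to_fls (fps_shift 1 B)"
        using B0 by (intro fls_eqI) (auto simp: fls_X_inv_times_conv_shift nat_add_distrib)
      thus ?thesis using * B1 by auto
    qed
    then obtain f where f: "\<And>r. r \<in> {1..k} \<Longrightarrow> fps_to_fls (expt p) ^ r * lift (qpow r expz)
        + lift (fls_const (1 / of_nat r) * fls_X_inv) = fps_to_fls (f r) \<and> fps_nth (f r) 0 = N"
      by metis
    obtain g where g: "\<And>j. j < k \<Longrightarrow> renz p j = fps_to_fls (g j) \<and> fps_nth (g j) 0 = binp N j"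
      using less.IH unfolding N_def by metis
    define S where "S = (\<Sum>r\<in>{1..k}. (-1) ^ (r - 1) * (f r * g (k - r)))"
    define c where "c = [:1 / rat_of_nat k:]"
    have ck: "c * of_nat k = 1"
      using False by (simp add: c_def of_nat_poly one_pCons)
    have "of_nat k * renz p k = fps_to_fls S"
      unfolding renz_rec S_def
      using f g False by (auto simp: fps_to_fls_sum fls_times_fps_to_fls fps_to_fls_power intro!: sum.cong)
    hence "fls_const c * (of_nat k * renz p k) = fps_to_fls (fps_const c * S)"
      by (simp add: fls_times_fps_to_fls)
    moreover have "fls_const c * of_nat k = 1"
      using ck by (simp add: fls_of_nat fls_const_mult_const)
    ultimately have "renz p k = fps_to_fls (fps_const c * S)"
      by (simp flip: mult.assoc)
    moreover have "fps_nth S 0 = (\<Sum>r\<in>{1..k}. (-1) ^ (r - 1) * (N * binp N (k - r)))"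
      unfolding S_def using f g False by (auto simp: fps_sum_nth fps_nth_power_0 intro!: sum.cong)
    hence "fps_nth (fps_const c * S) 0 = c * (of_nat k * binp N k)"
      by (simp add: binp_rec)
    hence "fps_nth (fps_const c * S) 0 = binp N k"
      by (simp add: ck flip: mult.assoc)
    ultimately show ?thesis unfolding N_def by blast
  qed
qed

section \<open>Summation over the trailing indices\<close>

text \<open>The possible indices of a block of k trailing zeros when the preceding index is
  n.\<close>

definition incr :: "nat \<Rightarrow> nat \<Rightarrow> nat list set" where
  "incr k n = {j. length j = k \<and> sorted_wrt (<) j \<and> (\<forall>x\<in>set j. n < x)}"

lemma incr_0: "incr 0 n = {[]}"
  by (auto simp: incr_def)

lemma incr_Suc: "incr (Suc k) n = (\<lambda>(x, j). x # j) ` Sigma {n<..} (incr k)"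
proof (intro equalityI subsetI)
  fix i assume "i \<in> incr (Suc k) n"
  thus "i \<in> (\<lambda>(x, j). x # j) ` Sigma {n<..} (incr k)"
    by (cases i) (auto simp: incr_def image_iff)
next
  fix i assume "i \<in> (\<lambda>(x, j). x # j) ` Sigma {n<..} (incr k)"
  thus "i \<in> incr (Suc k) n"
    by (force simp: incr_def)
qed

lemma has_sum_geometric_greaterThan:
  fixes q :: "'a::{real_normed_field, banach}"
  assumes "norm q < 1"
  shows "((\<lambda>x. q ^ x) has_sum (q ^ Suc n / (1 - q))) {n<..}"
proof -
  have "(\<lambda>x. q ^ x) sums (1 / (1 - q))"
    using assms by (rule geometric_sums)
  moreover have "summable (\<lambda>x. norm (q ^ x))"
    using assms by (simp add: norm_power summable_geometric)
  ultimately have "((\<lambda>x. q ^ x) has_sum (1 / (1 - q))) UNIV"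
    by (intro norm_summable_imp_has_sum)
  hence "((\<lambda>x. q ^ Suc n * q ^ x) has_sum (q ^ Suc n * (1 / (1 - q)))) UNIV"
    by (rule has_sum_cmult_right)
  moreover have "{n<..} = (\<lambda>x. Suc n + x) ` UNIV"
    by (auto simp: image_iff) presburger
  moreover have "inj ((+) (Suc n))"
    by simp
  ultimately show ?thesis
    by (simp only: has_sum_reindex o_def power_add mult_1_right times_divide_eq_right)
qed

text \<open>Fixing the first index x, the remaining k indices sum to q^(k x) times
  \<open>qelem k q\<close>, which leaves a geometric series of ratio q^(k + 1). Summability of the
  double sum stays a premise, because the real and the complex case obtain it differently.\<close>

lemma has_sum_incr_Suc:
  fixes q :: "'a::{real_normed_field, banach}"
  assumes q: "norm q < 1"
    and IH: "\<And>n. ((\<lambda>j. q ^ sum_list j) has_sum (q ^ (k * n) * qelem k q)) (incr k n)"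
  defines "f \<equiv> \<lambda>(x, j). q ^ (x + sum_list j)" and "g \<equiv> \<lambda>x. (q ^ Suc k) ^ x * qelem k q"
  shows "\<And>x. ((\<lambda>j. f (x, j)) has_sum g x) (incr k x)"
    and "(g has_sum (q ^ (Suc k * n) * qelem (Suc k) q)) {n<..}"
    and "f summable_on Sigma {n<..} (incr k)
      \<Longrightarrow> ((\<lambda>j. q ^ sum_list j) has_sum (q ^ (Suc k * n) * qelem (Suc k) q)) (incr (Suc k) n)"
proof -
  show 1: "((\<lambda>j. f (x, j)) has_sum g x) (incr k x)" for x
    using has_sum_cmult_right[OF IH[of x], of "q ^ x"]
    by (simp add: f_def g_def power_add power_mult power_mult_distrib mult.assoc)
  have "norm (q ^ Suc k) < 1"
    unfolding norm_power using q by (intro power_less_one_iff[THEN iffD2]) auto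
  from has_sum_cmult_left[OF has_sum_geometric_greaterThan[OF this, of n], of "qelem k q"]
  have "(g has_sum ((q ^ Suc k) ^ Suc n / (1 - q ^ Suc k) * qelem k q)) {n<..}"
    unfolding g_def .
  moreover have "(q ^ Suc k) ^ Suc n / (1 - q ^ Suc k) * qelem k q = q ^ (Suc k * n) * qelem (Suc k) q"
  proof -
    have "(q ^ Suc k) ^ Suc n = q ^ (Suc k * n) * q ^ Suc k"
      by (simp only: power_mult power_Suc2)
    moreover have "qelem (Suc k) q = qelem k q * (q ^ Suc k / (1 - q ^ Suc k))"
      by (simp add: qelem_def qpow_def)
    ultimately show ?thesis by (simp only: mult_ac times_divide_eq_left times_divide_eq_right)
  qed
  ultimately show 2: "(g has_sum (q ^ (Suc k * n) * qelem (Suc k) q)) {n<..}"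
    by simp
  assume "f summable_on Sigma {n<..} (incr k)"
  with 1 2 have "(f has_sum (q ^ (Suc k * n) * qelem (Suc k) q)) (Sigma {n<..} (incr k))"
    by (intro has_sum_SigmaI)
  moreover have "inj_on (\<lambda>(x, j). x # j) (Sigma {n<..} (incr k))"
    by (auto simp: inj_on_def)
  moreover have "(\<lambda>j. q ^ sum_list j) \<circ> (\<lambda>(x, j). x # j) = f"
    by (auto simp: f_def)
  ultimately show "((\<lambda>j. q ^ sum_list j) has_sum (q ^ (Suc k * n) * qelem (Suc k) q)) (incr (Suc k) n)"
    unfolding incr_Suc by (simp add: has_sum_reindex)
qed

text \<open>For nonnegative terms, summability of the iterated sums already gives summability of the
  double sum.\<close>

lemma has_sum_incr_real:
  fixes r :: real
  assumes "0 \<le> r" "r < 1"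
  shows "((\<lambda>j. r ^ sum_list j) has_sum (r ^ (k * n) * qelem k r)) (incr k n)"
proof (induction k arbitrary: n)
  case 0
  show ?case by (simp add: incr_0 qelem_def has_sum_finiteI)
next
  case (Suc k)
  have r: "norm r < 1" using assms by simp
  show ?case
    by (rule has_sum_incr_Suc(3)[OF r Suc],
        rule summable_on_SigmaI[OF has_sum_incr_Suc(1)[OF r Suc]
          has_sum_imp_summable[OF has_sum_incr_Suc(2)[OF r Suc]]])
       (use assms in auto)
qed

lemma has_sum_incr:
  fixes q :: complex
  assumes q: "norm q < 1"
  shows "((\<lambda>j. q ^ sum_list j) has_sum (q ^ (k * n) * qelem k q)) (incr k n)"
proof (induction k arbitrary: n)
  case 0
  show ?case by (simp add: incr_0 qelem_def has_sum_finiteI)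
next
  case (Suc k)
  \<comment> \<open>The real case at \<open>norm q\<close> yields absolute convergence.\<close>
  have "(\<lambda>j. norm q ^ sum_list j) summable_on incr (Suc k) n"
    by (rule has_sum_imp_summable[OF has_sum_incr_real]) (use q in auto)
  hence "(\<lambda>j. norm (q ^ sum_list j)) summable_on incr (Suc k) n"
    by (simp only: norm_power)
  hence "(\<lambda>j. q ^ sum_list j) summable_on incr (Suc k) n"
    by (rule abs_summable_summable)
  moreover have "inj_on (\<lambda>(x, j). x # j) (Sigma {n<..} (incr k))"
    by (auto simp: inj_on_def)
  ultimately have "(\<lambda>(x, j). q ^ (x + sum_list j)) summable_on Sigma {n<..} (incr k)"
    unfolding incr_Suc by (simp add: summable_on_reindex o_def case_prod_unfold)
  thus ?case
    by (rule has_sum_incr_Suc(3)[OF q Suc])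
qed

section \<open>Index lists of words with trailing zeros\<close>

abbreviation wd :: "nat list \<Rightarrow> (nat \<times> nat) list" where
  "wd a \<equiv> map (\<lambda>x. (x, 1)) a"

text \<open>The value 0 for the empty list turns "beyond the last index" into plain
  positivity.\<close>

definition last0 :: "nat list \<Rightarrow> nat" where
  "last0 i = (if i = [] then 0 else last i)"

lemma mono_of_zip:
  assumes "length i = length a"
  shows "mono_of i a = (\<Sum>p\<leftarrow>zip i a. Poly_Mapping.single (fst p) (snd p))"
  using assms by (simp add: mono_of_def sum_list_sum_nth atLeast0LessThan)

lemma mono_of_append:
  assumes "length i = length a" "length j = length b"
  shows "mono_of (i @ j) (a @ b) = mono_of i a + mono_of j b"
  using assms by (simp add: mono_of_zip)

lemma mono_of_replicate_0: "length j = k \<Longrightarrow> mono_of j (replicate k 0) = 0"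
  by (simp add: mono_of_def)

lemma sorted_wrt_less_le_last: "sorted_wrt (<) i \<Longrightarrow> x \<in> set i \<Longrightarrow> x \<le> last (i :: nat list)"
  by (induction i) (auto intro: less_imp_le dest: last_in_set)

text \<open>Zero exponents leave the monomial unchanged, so the trailing indices only have to
  increase beyond the prefix.\<close>

lemma idx_set_append_0:
  "idx_set (wd (u @ replicate k 0)) m
    = (\<lambda>(i, j). i @ j) ` Sigma (idx_set (wd u) m) (\<lambda>i. incr k (last0 i))"
proof (intro equalityI subsetI)
  fix l assume l: "l \<in> idx_set (wd (u @ replicate k 0)) m"
  define i j where "i = take (length u) l" and "j = drop (length u) l"
  have ij: "l = i @ j" "length i = length u" "length j = k"
    using l by (auto simp: i_def j_def idx_set_def)
  have "mono_of i u = m"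
    using l ij by (simp add: idx_set_def mono_of_append mono_of_replicate_0 o_def)
  hence "i \<in> idx_set (wd u) m"
    using l ij by (auto simp: idx_set_def sorted_wrt_append o_def)
  moreover have "j \<in> incr k (last0 i)"
    using l ij by (auto simp: idx_set_def sorted_wrt_append incr_def last0_def)
  ultimately show "l \<in> (\<lambda>(i, j). i @ j) ` Sigma (idx_set (wd u) m) (\<lambda>i. incr k (last0 i))"
    using ij by auto
next
  fix l assume "l \<in> (\<lambda>(i, j). i @ j) ` Sigma (idx_set (wd u) m) (\<lambda>i. incr k (last0 i))"
  then obtain i j where ij: "l = i @ j" "i \<in> idx_set (wd u) m" "j \<in> incr k (last0 i)"
    by auto
  have i: "length i = length u" "sorted_wrt (<) i" "\<forall>x\<in>set i. 0 < x" "mono_of i u = m"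
    using ij(2) by (auto simp: idx_set_def o_def)
  have j: "length j = k" "sorted_wrt (<) j" "\<forall>y\<in>set j. last0 i < y"
    using ij(3) by (auto simp: incr_def)
  have "x < y" if "x \<in> set i" "y \<in> set j" for x y
    using sorted_wrt_less_le_last[OF i(2) that(1)] j(3) that by (auto simp: last0_def split: if_splits)
  moreover have "0 < y" if "y \<in> set j" for y
    using j(3) that by auto
  ultimately show "l \<in> idx_set (wd (u @ replicate k 0)) m"
    using i j ij(1)
    by (auto simp: idx_set_def sorted_wrt_append mono_of_append mono_of_replicate_0 o_def)
qed

lemma inj_on_idx_append:
  "inj_on (\<lambda>(i, j). i @ j) (Sigma (idx_set w m) B)"
  by (auto simp: inj_on_def idx_set_def)

text \<open>A positive last exponent forces the variable of the last index to occur in m. Hence all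
  indices are bounded in terms of m, which is why \<open>idx_set\<close> is finite for such
  words.\<close>

lemma last0_idx_set:
  assumes "u = [] \<or> last u \<noteq> 0" "i \<in> idx_set (wd u) m"
  shows "last0 i = 0 \<or> last0 i \<in> Poly_Mapping.keys m"
proof (cases "u = []")
  case False
  have i: "length i = length u" "mono_of i u = m"
    using assms(2) by (auto simp: idx_set_def o_def)
  have "i \<noteq> []" using i(1) False by auto
  have "mono_of (butlast i @ [last i]) (butlast u @ [last u])
      = mono_of (butlast i) (butlast u) + mono_of [last i] [last u]"
    using i by (intro mono_of_append) auto
  hence "m = mono_of (butlast i) (butlast u) + Poly_Mapping.single (last i) (last u)"
    using i(2) False \<open>i \<noteq> []\<close> by (simp add: mono_of_def[of "[_]"])
  hence "Poly_Mapping.lookup m (last i) \<noteq> 0"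
    using assms(1) False by (simp add: lookup_add lookup_single)
  thus ?thesis using \<open>i \<noteq> []\<close>
    by (simp add: last0_def in_keys_iff)
qed (use assms(2) in \<open>simp add: idx_set_def last0_def\<close>)

lemma finite_idx_set:
  assumes "u = [] \<or> last u \<noteq> 0"
  shows "finite (idx_set (wd u) m)"
proof (rule finite_subset)
  have "x \<le> Max (insert 0 (Poly_Mapping.keys m))" if "i \<in> idx_set (wd u) m" "x \<in> set i" for i x
  proof -
    have "x \<le> last0 i"
      using that sorted_wrt_less_le_last[of i x] by (auto simp: idx_set_def last0_def)
    also have "\<dots> \<le> Max (insert 0 (Poly_Mapping.keys m))"
      using last0_idx_set[OF assms that(1)] by (intro Max_ge) auto
    finally show ?thesis .
  qed
  thus "idx_set (wd u) m \<subseteq>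
      {i. set i \<subseteq> {..Max (insert 0 (Poly_Mapping.keys m))} \<and> length i = length u}"
    by (auto simp: idx_set_def)
  show "finite {i. set i \<subseteq> {..Max (insert 0 (Poly_Mapping.keys m))} \<and> length i = length u}"
    by (rule finite_lists_length_eq) simp
qed

text \<open>The sum is grouped by the prefix i belonging to u. The zeros after i are summed in
  closed form by \<open>has_sum_incr\<close>, and their factors exp (t z) are collected with the one
  from \<open>last0 i\<close>.\<close>

lemma phi_fun_wd:
  assumes u: "u = [] \<or> last u \<noteq> 0" and z: "Re z < 0"
  shows "phi_fun (wd (u @ replicate k 0)) m t z =
    (\<Sum>i\<in>idx_set (wd u) m. exp ((of_nat (sum_list i) + of_nat (length u) * of_real t) * z)
       * exp ((of_nat (last0 i) + of_real t) * z) ^ k * qelem k (exp z))"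
proof -
  define q where "q = exp z"
  have q: "norm q < 1" using z by (simp add: q_def)
  define w where "w = wd (u @ replicate k 0)"
  define E where "E = (\<lambda>i. \<Sum>l<length w. (of_nat (i ! l) + complex_of_real t) * of_nat (snd (w ! l)))"
  define c where "c = (\<lambda>i. exp (z * (of_nat (sum_list i) + of_nat (length u + k) * complex_of_real t)))"
  define T where "T = (\<lambda>i. c i * (q ^ (k * last0 i) * qelem k q))"
  have E: "exp (z * E l) = exp (z * (of_nat (sum_list l) + of_nat (length u + k) * of_real t))"
    if "length l = length u + k" for l
  proof -
    have "E l = (\<Sum>x<length u + k. of_nat (l ! x) + complex_of_real t)"
      unfolding E_def by (intro sum.cong) (auto simp: w_def nth_append)
    also have "\<dots> = of_nat (sum_list l) + of_nat (length u + k) * of_real t"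
      using that by (simp add: sum.distrib sum_list_sum_nth atLeast0LessThan)
    finally show ?thesis by simp
  qed
  have one: "((\<lambda>l. exp (z * E l)) has_sum T i) ((@) i ` incr k (last0 i))"
    if i: "i \<in> idx_set (wd u) m" for i
  proof -
    have len: "length i = length u" using i by (simp add: idx_set_def)
    have "((\<lambda>j. c i * q ^ sum_list j) has_sum T i) (incr k (last0 i))"
      unfolding T_def by (intro has_sum_cmult_right has_sum_incr q)
    moreover have "exp (z * E (i @ j)) = c i * q ^ sum_list j" if "j \<in> incr k (last0 i)" for j
      using that len
      by (simp add: E incr_def c_def q_def exp_add ring_distribs flip: exp_of_nat_mult)
         (simp add: mult_ac)
    ultimately have "((\<lambda>j. exp (z * E (i @ j))) has_sum T i) (incr k (last0 i))"
      by (subst has_sum_cong) auto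
    thus ?thesis by (subst has_sum_reindex) (auto simp: inj_on_def o_def)
  qed
  \<comment> \<open>There are only finitely many prefixes and their blocks are disjoint, so the
    closed forms simply add up.\<close>
  have "((\<lambda>l. exp (z * E l)) has_sum sum T I) (\<Union>i\<in>I. (@) i ` incr k (last0 i))"
    if "finite I" "I \<subseteq> idx_set (wd u) m" for I
    using that
  proof (induction I)
    case (insert i I)
    have "(@) i ` incr k (last0 i) \<inter> (\<Union>i\<in>I. (@) i ` incr k (last0 i)) = {}"
      using insert.hyps insert.prems by (auto simp: idx_set_def)
    with insert one[of i] show ?case
      by (simp add: has_sum_Un_disjoint)
  qed simp
  from this[OF finite_idx_set[OF u] order_refl]
  have "((\<lambda>l. exp (z * E l)) has_sum sum T (idx_set (wd u) m))
      (\<Union>i\<in>idx_set (wd u) m. (@) i ` incr k (last0 i))" .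
  also have "(\<Union>i\<in>idx_set (wd u) m. (@) i ` incr k (last0 i)) = idx_set w m"
    unfolding w_def idx_set_append_0 by auto
  finally have "((\<lambda>l. exp (z * E l)) has_sum sum T (idx_set (wd u) m)) (idx_set w m)" .
  hence phi: "phi_fun w m t z = sum T (idx_set (wd u) m)"
    unfolding phi_fun_def E_def by (rule infsumI)
  have "T i = exp ((of_nat (sum_list i) + of_nat (length u) * of_real t) * z)
       * exp ((of_nat (last0 i) + of_real t) * z) ^ k * qelem k (exp z)" for i
  proof -
    have "c i * q ^ (k * last0 i) = exp ((of_nat (sum_list i) + of_nat (length u) * of_real t) * z)
       * exp ((of_nat (last0 i) + of_real t) * z) ^ k"
      by (simp add: c_def q_def flip: exp_add exp_of_nat_mult) (simp add: algebra_simps)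
    thus ?thesis by (simp add: T_def q_def flip: mult.assoc)
  qed
  thus ?thesis unfolding phi[unfolded w_def] by (intro sum.cong refl)
qed

section \<open>The regularized series of words with bottom row one\<close>

text \<open>A nonzero Laurent series has no zeros in a punctured neighbourhood of 0, while the left
  half-plane accumulates at 0.\<close>

lemma laurent_left_unique:
  assumes "laurent_left F f" "laurent_left G f"
  shows "F = G"
proof (rule ccontr)
  assume "F \<noteq> G"
  have "eval_fls F has_laurent_expansion F" "eval_fls G has_laurent_expansion G"
    using assms by (auto simp: laurent_left_def has_laurent_expansion_def)
  hence "(\<lambda>z. eval_fls F z - eval_fls G z) has_laurent_expansion F - G"
    by (rule has_laurent_expansion_diff)
  hence "eventually (\<lambda>z. eval_fls F z - eval_fls G z \<noteq> 0) (at 0)"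
    using \<open>F \<noteq> G\<close> by (intro has_laurent_expansion_nonzero_imp_eventually_nonzero) auto
  hence "eventually (\<lambda>z. eval_fls F z - eval_fls G z \<noteq> 0) (at 0 within {z. Re z < 0})"
    by (rule filter_leD[OF at_le, rotated]) auto
  moreover have "eventually (\<lambda>z. f z = eval_fls F z) (at 0 within {z. Re z < 0})"
    "eventually (\<lambda>z. f z = eval_fls G z) (at 0 within {z. Re z < 0})"
    using assms by (auto simp: laurent_left_def)
  ultimately have "eventually (\<lambda>z. False) (at 0 within {z. Re z < 0})"
    by eventually_elim auto
  moreover have "at 0 within {z. Re z < 0} \<noteq> bot"
  proof -
    have "(0::complex) islimpt {z. Re z < 0}"
      unfolding islimpt_approachable
    proof (intro allI impI)
      fix e :: real assume "e > 0"
      thus "\<exists>x'\<in>{z. Re z < 0}. x' \<noteq> 0 \<and> dist x' 0 < e"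
        by (intro bexI[of _ "complex_of_real (- e / 2)"]) auto
    qed
    thus ?thesis by (simp add: trivial_limit_within)
  qed
  ultimately show False by simp
qed

section \<open>Identification of the regularized series by its values in t\<close>

definition evt :: "complex \<Rightarrow> rat poly \<Rightarrow> complex" where
  "evt x p = poly (map_poly of_rat p) x"

lemma coeff_hom_of_rat: "coeff_hom (of_rat :: rat \<Rightarrow> 'a::field_char_0)"
  by standard (auto simp: of_rat_add of_rat_mult)

lemma coeff_hom_evt: "coeff_hom (evt x)"
proof -
  interpret coeff_hom "map_poly (of_rat :: rat \<Rightarrow> complex)"
    by (rule coeff_hom.coeff_hom_map_poly[OF coeff_hom_of_rat])
  show ?thesis
    by standard (simp_all add: evt_def add mult one)
qed

lemma evt_pCons: "evt x (pCons c p) = of_rat c + x * evt x p"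
  by (simp add: evt_def map_poly_pCons)

lemma evt_0: "evt x 0 = 0"
  by (simp add: evt_def)

lemma evt_smult: "evt x (smult c p) = of_rat c * evt x p"
  by (simp add: evt_def map_poly_smult of_rat_mult)

lemma eval_t_eq: "eval_t F t = fls_map (evt (of_real t)) F"
  by (simp add: eval_t_def fls_map_def evt_def)

lemma evt_eq_imp_eq:
  assumes "\<And>t. t \<ge> 0 \<Longrightarrow> evt (complex_of_real t) p = evt (complex_of_real t) q"
  shows "p = q"
proof -
  let ?h = "map_poly (of_rat :: rat \<Rightarrow> complex)"
  have "infinite (complex_of_real ` {0..})"
    using infinite_Ici[of "0::real"] by (subst finite_image_iff) (auto simp: inj_on_def)
  moreover have "complex_of_real ` {0..} \<subseteq> {x. poly (?h p - ?h q) x = 0}"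
    using assms by (auto simp: evt_def)
  ultimately have "?h p - ?h q = 0"
    using poly_roots_finite finite_subset by blast
  hence "coeff (?h p) n = coeff (?h q) n" for n by simp
  thus ?thesis by (intro poly_eqI) (simp add: coeff_map_poly)
qed

text \<open>The description in \<open>phi\<close> has at most one solution: each t \<ge> 0 fixes the
  Laurent series, and a polynomial is fixed by its values at all t \<ge> 0.\<close>

lemma phi_eqI:
  assumes "\<And>t. t \<ge> 0 \<Longrightarrow> laurent_left (eval_t F t) (phi_fun w m t)"
  shows "phi w m = F"
  unfolding phi_def
proof (rule the_equality)
  fix G assume G: "\<forall>t\<ge>0. laurent_left (eval_t G t) (phi_fun w m t)"
  show "G = F"
  proof (intro fls_eqI evt_eq_imp_eq)
    fix n t assume "(t::real) \<ge> 0"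
    hence "eval_t G t = eval_t F t"
      using G assms laurent_left_unique by blast
    hence "fls_nth (eval_t G t) n = fls_nth (eval_t F t) n" by simp
    thus "evt (of_real t) (fls_nth G n) = evt (of_real t) (fls_nth F n)"
      by (simp add: eval_t_eq coeff_hom.nth[OF coeff_hom_evt])
  qed
qed (use assms in blast)

lemma of_rat_fact: "of_rat (fact n) = fact n"
  by (metis of_nat_fact of_rat_of_nat_eq)

lemma eval_t_expt: "eval_t (fps_to_fls (expt p)) t = fps_to_fls (fps_exp (evt (of_real t) p))"
proof -
  interpret coeff_hom "evt (of_real t)" by (rule coeff_hom_evt)
  show ?thesis
    by (simp add: eval_t_eq fls_map_fps_to_fls expt_def fps_exp_def evt_smult power of_rat_divide
          of_rat_fact)
qed

lemma eval_t_lift: "eval_t (lift F) t = fls_map of_rat F"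
  by (intro fls_eqI)
     (simp add: eval_t_eq coeff_hom.nth[OF coeff_hom_evt] lift_nth evt_pCons evt_0
        coeff_hom.nth[OF coeff_hom_of_rat])

text \<open>\<open>of_rat\<close> respects field operations and the exponential series. Thus the
  complex expansion of \<open>qelem k (exp z)\<close> is the image of a rational series.\<close>

lemma fls_map_of_rat_qelem:
  "fls_map of_rat (qelem k expz) = (qelem k expz :: 'a::field_char_0 fls)"
proof -
  let ?h = "of_rat :: rat \<Rightarrow> 'a"
  have hom: "coeff_hom (fls_map ?h)"
    by (rule coeff_hom.coeff_hom_fls_map[OF coeff_hom_of_rat])
  interpret coeff_hom "fls_map ?h" by (rule hom)
  have expz: "fls_map ?h expz = expz"
    by (simp add: coeff_hom.fls_map_fps_to_fls[OF coeff_hom_of_rat] fps_exp_def of_rat_divide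
          of_rat_fact)
  have "fls_map ?h (qpow j expz) = qpow j expz" if "j > 0" for j
  proof -
    have "1 - expz ^ j \<noteq> (0 :: rat fls)"
      using expz_power_neq_1[OF that] by (metis right_minus_eq)
    thus ?thesis
      by (simp add: qpow_def coeff_hom_divide[OF hom] power diff one expz)
  qed
  thus ?thesis by (simp add: qelem_def prod)
qed

lemma has_laurent_expansion_qelem:
  "(\<lambda>z. qelem k (exp z)) has_laurent_expansion qelem k expz"
  unfolding qelem_def qpow_def
  by (intro laurent_expansion_intros has_laurent_expansion_fps[OF has_fps_expansion_exp1])

text \<open>The closed form in \<open>phi_fun_wd\<close> is built from exponentials and
  \<open>qelem k (exp z)\<close>, so its expansion at 0 is the same expression in formal series. It
  agrees with \<open>phi_fun\<close> only for Re z < 0, hence the one-sided filter.\<close>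

lemma phi_wd:
  assumes u: "u = [] \<or> last u \<noteq> 0"
  shows "phi (wd (u @ replicate k 0)) m =
    (\<Sum>i\<in>idx_set (wd u) m. fps_to_fls (expt [:of_nat (sum_list i), of_nat (length u):])
       * fps_to_fls (expt [:of_nat (last0 i), 1:]) ^ k * lift (qelem k expz))"
    (is "_ = ?F")
proof (rule phi_eqI)
  fix t :: real
  interpret coeff_hom "\<lambda>F. eval_t F t"
    unfolding eval_t_eq by (rule coeff_hom.coeff_hom_fls_map[OF coeff_hom_evt])
  let ?f = "\<lambda>z. \<Sum>i\<in>idx_set (wd u) m.
       exp ((of_nat (sum_list i) + of_nat (length u) * of_real t) * z)
       * exp ((of_nat (last0 i) + of_real t) * z) ^ k * qelem k (exp z)"
  have ev: "evt (of_real t) [:of_nat a, of_nat b:] = of_nat a + of_nat b * of_real t" for a b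
    by (simp add: evt_pCons evt_0 mult.commute)
  have "eval_t ?F t = (\<Sum>i\<in>idx_set (wd u) m.
      fps_to_fls (fps_exp (of_nat (sum_list i) + of_nat (length u) * of_real t))
      * fps_to_fls (fps_exp (of_nat (last0 i) + of_real t)) ^ k * qelem k expz)"
    using ev[of _ 1]
    by (simp add: sum mult power eval_t_expt eval_t_lift fls_map_of_rat_qelem ev)
  also have "?f has_laurent_expansion \<dots>"
    by (intro laurent_expansion_intros has_laurent_expansion_qelem
          has_laurent_expansion_fps[OF has_fps_expansion_exp])
  finally have F: "?f has_laurent_expansion eval_t ?F t" .
  have "eventually (\<lambda>z. eval_fls (eval_t ?F t) z = ?f z) (at 0)"
    using F by (simp add: has_laurent_expansion_def)
  hence "eventually (\<lambda>z. eval_fls (eval_t ?F t) z = ?f z) (at 0 within {z. Re z < 0})"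
    by (rule filter_leD[OF at_le, rotated]) auto
  moreover have "eventually (\<lambda>z. Re z < 0) (at 0 within {z. Re z < 0})"
    by (simp add: eventually_at_filter)
  ultimately have "eventually (\<lambda>z. phi_fun (wd (u @ replicate k 0)) m t z = eval_fls (eval_t ?F t) z)
      (at 0 within {z. Re z < 0})"
    by eventually_elim (simp only: phi_fun_wd[OF u])
  with F show "laurent_left (eval_t ?F t) (phi_fun (wd (u @ replicate k 0)) m t)"
    by (simp add: laurent_left_def has_laurent_expansion_def)
qed

section \<open>Renormalization\<close>

declare phi_minus.simps [simp del]

text \<open>Both summands lie pointwise below m. Finiteness matters because the sum in
  \<open>xmul\<close> would default to 0 over an infinite set.\<close>

lemma finite_add_eq: "finite {(a, b). a + b = (m :: xmono)}"
proof -
  define M where "M = Max (insert 0 (Poly_Mapping.lookup m ` Poly_Mapping.keys m))"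
  define A where "A = {a. \<exists>b. a + b = m}"
  have "Poly_Mapping.lookup ` A \<subseteq> {f. \<forall>x. (x \<in> Poly_Mapping.keys m \<longrightarrow> f x \<in> {..M}) \<and>
      (x \<notin> Poly_Mapping.keys m \<longrightarrow> f x = 0)}"
  proof clarsimp
    fix a x assume "a \<in> A"
    then obtain b where b: "m = a + b" by (auto simp: A_def)
    have le: "Poly_Mapping.lookup a x \<le> Poly_Mapping.lookup m x"
      by (simp add: b lookup_add)
    moreover have "Poly_Mapping.lookup m x \<le> M" if "x \<in> Poly_Mapping.keys m"
      unfolding M_def using that by (intro Max_ge) auto
    ultimately show "(x \<in> Poly_Mapping.keys m \<longrightarrow> Poly_Mapping.lookup a x \<le> M) \<and>
        (x \<notin> Poly_Mapping.keys m \<longrightarrow> Poly_Mapping.lookup a x = 0)"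
      by (auto simp: in_keys_iff)
  qed
  hence "finite (Poly_Mapping.lookup ` A)"
    by (rule finite_subset) (rule finite_set_of_finite_funs, auto)
  hence "finite A"
    by (rule finite_imageD) (simp add: inj_on_def)
  moreover have "{(a, b). a + b = m} \<subseteq> A \<times> A"
    unfolding A_def by (clarsimp, intro conjI exI refl) (rule add.commute)
  ultimately show ?thesis
    using finite_subset by (metis finite_cartesian_product)
qed

lemma xmul_const: "xmul f (\<lambda>m. if m = 0 then c else 0) m = f m * c"
proof -
  have "xmul f (\<lambda>m. if m = 0 then c else 0) m
      = (\<Sum>(a, b)\<in>{(m, 0 :: xmono)}. f a * (if b = 0 then c else 0))"
    unfolding xmul_def by (rule sum.mono_neutral_right) (use finite_add_eq in \<open>auto split: if_splits\<close>)
  thus ?thesis by simp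
qed

lemma polP_fps_to_fls: "polP (fps_to_fls f) = 0"
  by (simp add: polP_def)

lemma polP_0: "polP 0 = 0"
  using polP_fps_to_fls[of 0] by simp

lemma polP_diff: "polP (F - G) = polP F - polP G"
  by (simp add: polP_def)

lemma polP_lift_counter: "k > 0 \<Longrightarrow> polP (lift (counter k)) = lift (counter k)"
proof -
  assume "k > 0"
  hence "fls_regpart (lift (counter k)) = 0"
    by (intro fps_ext) (simp add: lift_nth counter_polar)
  thus ?thesis by (simp add: polP_def)
qed

lemma idx_set_Nil: "idx_set [] m = (if m = 0 then {[]} else {})"
  by (auto simp: idx_set_def mono_of_def)

lemma expt_0: "expt 0 = 1"
  by (intro fps_ext) (auto simp: expt_def power_0_left)

lemma split_trailing_zeros:
  obtains u k where "a = u @ replicate k 0" "u = [] \<or> last u \<noteq> (0::nat)"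
proof (induction a arbitrary: thesis rule: rev_induct)
  case Nil
  show ?case by (rule Nil[of "[]" 0]) auto
next
  case (snoc x a)
  show ?case
  proof (cases "x = 0")
    case True
    obtain u k where "a = u @ replicate k 0" "u = [] \<or> last u \<noteq> 0"
      by (rule snoc.IH)
    thus ?thesis
      using True by (intro snoc.prems[of u "Suc k"]) (auto simp: replicate_append_same)
  next
    case False
    thus ?thesis by (intro snoc.prems[of "a @ [x]" 0]) auto
  qed
qed

text \<open>The Bogoliubov preparation, to which both \<open>phi_minus\<close> (on nonempty words)
  and \<open>phi_plus\<close> apply their projections.\<close>

definition phi_bar :: "(nat \<times> nat) list \<Rightarrow> rat poly fls xser" where
  "phi_bar w m = phi w m +
    (\<Sum>i\<in>{1..<length w}. xmul (phi (take i w)) (phi_minus (drop i w)) m)"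

text \<open>Exchanging the sums gives, for each prefix i, an exponential times \<open>renz\<close>
  at p = t + \<open>last0 i\<close>. That is regular by \<open>renz_regular\<close>, and the
  exponential has constant term 1.\<close>

lemma convolution_regular:
  assumes u: "u = [] \<or> last u \<noteq> 0"
  shows "\<exists>f. (\<Sum>l\<le>k. phi (wd (u @ replicate l 0)) m * lift (counter (k - l))) = fps_to_fls f
    \<and> fps_nth f 0 = (\<Sum>i\<in>idx_set (wd u) m. binp (- [:of_nat (last0 i), 1:] - [:1/2:]) k)"
proof -
  define e where "e = (\<lambda>i. expt [:of_nat (sum_list i), of_nat (length u):])"
  have "\<exists>f. \<forall>p. renz p k = fps_to_fls (f p) \<and> fps_nth (f p) 0 = binp (- p - [:1/2:]) k"
    by (intro choice allI renz_regular)
  then obtain f where f: "\<And>p. renz p k = fps_to_fls (f p)"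
      "\<And>p. fps_nth (f p) 0 = binp (- p - [:1/2:]) k"
    by blast
  define g where "g = (\<Sum>i\<in>idx_set (wd u) m. e i * f [:of_nat (last0 i), 1:])"
  have "(\<Sum>l\<le>k. phi (wd (u @ replicate l 0)) m * lift (counter (k - l)))
      = (\<Sum>i\<in>idx_set (wd u) m. fps_to_fls (e i) * renz [:of_nat (last0 i), 1:] k)"
    unfolding phi_wd[OF u] sum_distrib_right renz_def sum_distrib_left e_def
    by (subst sum.swap) (simp add: mult.assoc)
  also have "\<dots> = fps_to_fls g"
    using f by (simp add: g_def fps_to_fls_sum fls_times_fps_to_fls)
  finally have "(\<Sum>l\<le>k. phi (wd (u @ replicate l 0)) m * lift (counter (k - l))) = fps_to_fls g" .
  moreover have "fps_nth g 0 = (\<Sum>i\<in>idx_set (wd u) m. binp (- [:of_nat (last0 i), 1:] - [:1/2:]) k)"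
    using f expt_power_nth(1)[of _ 1] by (simp add: g_def fps_sum_nth e_def)
  ultimately show ?thesis by blast
qed

text \<open>A cut inside u leaves a suffix without counterterm; a cut after u leaves zeros, whose
  counterterm is constant in X. What remains is the full convolution, except that for empty u the
  cut before the whole word is not allowed and its term is subtracted.\<close>

lemma phi_bar_wd:
  assumes u: "u = [] \<or> last u \<noteq> 0" and ne: "u @ replicate k 0 \<noteq> []"
    and IH: "\<And>v j. length v + j < length u + k \<Longrightarrow> v = [] \<or> last v \<noteq> 0 \<Longrightarrow>
      phi_minus (wd (v @ replicate j 0)) = (\<lambda>m. if v = [] \<and> m = 0 then lift (counter j) else 0)"
  shows "phi_bar (wd (u @ replicate k 0)) m =
    (\<Sum>l\<le>k. phi (wd (u @ replicate l 0)) m * lift (counter (k - l)))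
    - (if u = [] \<and> m = 0 then lift (counter k) else 0)"
proof -
  define w where "w = wd (u @ replicate k 0)"
  define X where "X = (\<lambda>i. xmul (phi (take i w)) (phi_minus (drop i w)) m)"
  define Y where "Y = (\<lambda>l. phi (wd (u @ replicate l 0)) m * lift (counter (k - l)))"
  have X1: "X i = 0" if "1 \<le> i" "i < length u" for i
  proof -
    have "drop i w = wd (drop i u @ replicate k 0)"
      using that by (simp add: w_def drop_map)
    also have "phi_minus \<dots> = (\<lambda>m. 0)"
      using that u by (subst IH) auto
    finally show ?thesis by (simp add: X_def xmul_def)
  qed
  have X2: "X (length u + l) = Y l" if "l < k" "u \<noteq> [] \<or> l > 0" for l
  proof -
    have "drop (length u + l) w = wd ([] @ replicate (k - l) 0)"
      by (simp add: w_def drop_map)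
    moreover have "k - l < length u + k"
      using that by (cases u) auto
    hence "phi_minus (wd ([] @ replicate (k - l) 0)) = (\<lambda>m. if m = 0 then lift (counter (k - l)) else 0)"
      by (subst IH) auto
    ultimately have "X (length u + l) = phi (take (length u + l) w) m * lift (counter (k - l))"
      by (simp only: X_def xmul_const)
    also have "take (length u + l) w = wd (u @ replicate l 0)"
      using that by (simp add: w_def take_map)
    finally show ?thesis by (simp add: Y_def)
  qed
  have Yk: "Y k = phi w m"
    by (simp add: Y_def w_def counter_0 lift.one)
  have len: "length w = length u + k" by (simp add: w_def)
  have "(\<Sum>i\<in>{1..<length w}. X i) = (\<Sum>l<k. Y l) - (if u = [] \<and> m = 0 then lift (counter k) else 0)"
  \<comment> \<open>For empty u the term l = 0 belongs to the excluded cut at position 0. Otherwise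
    it is the cut just after u, which is allowed.\<close>
  proof (cases "u = []")
    case True
    hence "k > 0" using ne by auto
    have "Y 0 = (if m = 0 then lift (counter k) else 0)"
      using phi_wd[of "[]" 0 m]
      by (simp add: Y_def True idx_set_Nil expt_0 qelem_def lift.one)
    moreover have "(\<Sum>l<k. Y l) = Y 0 + (\<Sum>l\<in>{1..<k}. Y l)"
      using \<open>k > 0\<close> by (simp add: sum.atLeast_Suc_lessThan flip: atLeast0LessThan)
    moreover have "(\<Sum>i\<in>{1..<length w}. X i) = (\<Sum>l\<in>{1..<k}. Y l)"
      using X2 True len by (intro sum.cong) auto
    ultimately show ?thesis using True by simp
  next
    case False
    have "(\<Sum>i\<in>{1..<length w}. X i) = (\<Sum>i\<in>{1..<length u}. X i) + (\<Sum>i\<in>{length u..<length u + k}. X i)"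
      using False by (subst sum.atLeastLessThan_concat) (auto simp: len Suc_le_eq)
    also have "(\<Sum>i\<in>{1..<length u}. X i) = 0"
      using X1 by (intro sum.neutral) auto
    also have "(\<Sum>i\<in>{length u..<length u + k}. X i) = (\<Sum>l<k. X (length u + l))"
      using sum.shift_bounds_nat_ivl[of X 0 "length u" k] by (simp add: add.commute atLeast0LessThan)
    also have "\<dots> = (\<Sum>l<k. Y l)"
      using X2 False by (intro sum.cong) auto
    finally show ?thesis using False by simp
  qed
  moreover have "(\<Sum>l\<le>k. Y l) = (\<Sum>l<k. Y l) + Y k"
    by (simp flip: lessThan_Suc_atMost)
  ultimately show ?thesis
    unfolding phi_bar_def w_def[symmetric] using Yk by (simp add: X_def Y_def)
qed

text \<open>By induction on the length, \<open>phi_bar\<close> is a regular series minus a purely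
  polar counterterm, and - P returns that counterterm.\<close>

lemma phi_minus_wd:
  assumes "u = [] \<or> last u \<noteq> 0"
  shows "phi_minus (wd (u @ replicate k 0)) = (\<lambda>m. if u = [] \<and> m = 0 then lift (counter k) else 0)"
  using assms
proof (induction "length u + k" arbitrary: u k rule: less_induct)
  case less
  show ?case
  proof (cases "u @ replicate k 0 = []")
    case True
    moreover have "phi_minus [] = xone"
      by (subst phi_minus.simps) simp
    ultimately show ?thesis by (auto simp: xone_def counter_0 lift.one)
  next
    case False
    have bar: "phi_minus (wd (u @ replicate k 0)) m = - polP (phi_bar (wd (u @ replicate k 0)) m)" for m
      using False by (subst phi_minus.simps) (auto simp: phi_bar_def)
    have "phi_minus (wd (u @ replicate k 0)) m = (if u = [] \<and> m = 0 then lift (counter k) else 0)" for m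
    proof -
      obtain f where f: "(\<Sum>l\<le>k. phi (wd (u @ replicate l 0)) m * lift (counter (k - l))) = fps_to_fls f"
        using convolution_regular[OF less.prems] by blast
      have *: "phi_bar (wd (u @ replicate k 0)) m =
          fps_to_fls f - (if u = [] \<and> m = 0 then lift (counter k) else 0)"
        using phi_bar_wd[OF less.prems False less.hyps] f by simp
      show ?thesis
        unfolding bar * polP_diff polP_fps_to_fls
        using False by (auto simp: polP_lift_counter polP_0)
    qed
    thus ?thesis by blast
  qed
qed

text \<open>Removing the polar part cancels the subtracted counterterm in \<open>phi_bar_wd\<close>,
  so \<open>phi_plus\<close> is the regular convolution, whose constant term is known.\<close>

lemma Mq_eq:
  assumes u: "u = [] \<or> last u \<noteq> 0"
  shows "Mq (u @ replicate k 0) m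
    = (\<Sum>i\<in>idx_set (wd u) m. binp (- [:of_nat (last0 i), 1:] - [:1/2:]) k)"
proof (cases "u @ replicate k 0 = []")
  case True
  thus ?thesis by (auto simp: Mq_def xone_def idx_set_Nil binp_0)
next
  case False
  obtain f where f: "(\<Sum>l\<le>k. phi (wd (u @ replicate l 0)) m * lift (counter (k - l))) = fps_to_fls f"
      "fps_nth f 0 = (\<Sum>i\<in>idx_set (wd u) m. binp (- [:of_nat (last0 i), 1:] - [:1/2:]) k)"
    using convolution_regular[OF u] by blast
  define c where "c = (if u = [] \<and> m = 0 then lift (counter k) else 0)"
  have *: "phi_bar (wd (u @ replicate k 0)) m = fps_to_fls f - c"
    using phi_bar_wd[OF u False phi_minus_wd] f(1) by (simp add: c_def)
  have "polP c = c"
    using False by (auto simp: c_def polP_lift_counter polP_0)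
  have "phi_plus (wd (u @ replicate k 0)) m = fps_to_fls f - c - polP (fps_to_fls f - c)"
    unfolding phi_plus_def *[symmetric] by (simp add: phi_bar_def)
  also have "\<dots> = fps_to_fls f"
    by (simp add: polP_diff polP_fps_to_fls \<open>polP c = c\<close>)
  finally show ?thesis using False f(2) by (auto simp: Mq_def Zren_def)
qed

text \<open>The bound does not depend on m; this will place \<open>RenQSym\<close> in k[[X]][t]
  rather than merely in k[t][[X]].\<close>

lemma degree_Mq: "degree (Mq a m) \<le> length a"
proof -
  obtain u k where a: "a = u @ replicate k 0" "u = [] \<or> last u \<noteq> 0"
    by (rule split_trailing_zeros)
  have "degree (Mq a m) \<le> k"
    unfolding a(1) Mq_eq[OF a(2)]
    by (intro degree_sum_le degree_binp finite_idx_set a) auto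
  thus ?thesis using a(1) by simp
qed

section \<open>Quasi-shuffle product of truncated monomial sums\<close>

text \<open>For increasing \<open>L\<close>, the monomial sum of the composition with indices taken
  from \<open>L\<close>. The recursion asks whether the first index of \<open>L\<close> is
  used.\<close>

fun trunc_qsym :: "nat list \<Rightarrow> nat list \<Rightarrow> xmono \<Rightarrow>\<^sub>0 nat" where
  "trunc_qsym L [] = 1"
| "trunc_qsym [] (x # a) = 0"
| "trunc_qsym (n # L) (x # a)
    = Poly_Mapping.single (Poly_Mapping.single n x) 1 * trunc_qsym L a + trunc_qsym L (x # a)"

text \<open>The variable n is used by the first factor, by the second, by both or by neither. The
  first three cases match the three terms of the quasi-shuffle, and the last is the induction
  hypothesis.\<close>

lemma trunc_qsym_mult: "trunc_qsym L a * trunc_qsym L b = (\<Sum>c\<in>#qsh a b. trunc_qsym L c)"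
proof (induction L arbitrary: a b)
  case Nil
  show ?case
    by (cases a; cases b) (simp_all add: image_mset.compositionality o_def)
next
  case (Cons n L)
  show ?case
  proof (cases "a = [] \<or> b = []")
    case True
    thus ?thesis by (cases a; cases b) auto
  next
    case False
    then obtain x a' y b' where ab: "a = x # a'" "b = y # b'"
      by (cases a; cases b) auto
    let ?X = "\<lambda>x. Poly_Mapping.single (Poly_Mapping.single n x) (1::nat)"
    have X: "?X (x + y) = ?X x * ?X y"
      by (simp add: mult_single single_add)
    have *: "(\<Sum>c\<in>#C. ?X z * trunc_qsym L c + trunc_qsym L (z # c))
        = ?X z * (\<Sum>c\<in>#C. trunc_qsym L c) + (\<Sum>c\<in>#C. trunc_qsym L (z # c))" for z C
      by (simp add: sum_mset.distrib sum_mset_distrib_left)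
    have "trunc_qsym L a * trunc_qsym L b = (\<Sum>c\<in>#qsh a' b. trunc_qsym L (x # c))
        + (\<Sum>c\<in>#qsh a b'. trunc_qsym L (y # c)) + (\<Sum>c\<in>#qsh a' b'. trunc_qsym L ((x + y) # c))"
      using Cons[of a b] by (simp add: ab image_mset.compositionality o_def)
    moreover have "(\<Sum>c\<in>#qsh a b. trunc_qsym (n # L) c)
        = ?X x * (trunc_qsym L a' * trunc_qsym L b) + (\<Sum>c\<in>#qsh a' b. trunc_qsym L (x # c))
        + (?X y * (trunc_qsym L a * trunc_qsym L b') + (\<Sum>c\<in>#qsh a b'. trunc_qsym L (y # c)))
        + (?X (x + y) * (trunc_qsym L a' * trunc_qsym L b')
            + (\<Sum>c\<in>#qsh a' b'. trunc_qsym L ((x + y) # c)))"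
      by (simp add: ab image_mset.compositionality o_def * Cons del: One_nat_def)
    ultimately show ?thesis
      by (simp add: ab X algebra_simps del: One_nat_def)
  qed
qed

definition sublists_of :: "nat list \<Rightarrow> nat \<Rightarrow> nat list set" where
  "sublists_of L k = {i. length i = k \<and> sorted_wrt (<) i \<and> set i \<subseteq> set L}"

lemma finite_sublists_of: "finite (sublists_of L k)"
  by (rule finite_subset[OF _ finite_lists_length_eq[of "set L" k]]) (auto simp: sublists_of_def)

lemma trunc_qsym_eq_sum:
  assumes "sorted_wrt (<) L"
  shows "trunc_qsym L a = (\<Sum>i\<in>sublists_of L (length a). Poly_Mapping.single (mono_of i a) 1)"
  using assms
proof (induction L a rule: trunc_qsym.induct)
  case (1 L)
  have "sublists_of L 0 = {[]}" by (auto simp: sublists_of_def)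
  thus ?case by (simp add: mono_of_def del: One_nat_def)
next
  case (2 x a)
  have "sublists_of [] (Suc n) = {}" for n by (auto simp: sublists_of_def)
  thus ?case by simp
next
  case (3 n L x a)
  let ?k = "length a"
  have split: "sublists_of (n # L) (Suc ?k)
      = (Cons n) ` sublists_of L ?k \<union> sublists_of L (Suc ?k)"
  proof (intro equalityI subsetI)
    fix i assume i: "i \<in> sublists_of (n # L) (Suc ?k)"
    then obtain y j where y: "i = y # j" by (cases i) (auto simp: sublists_of_def)
    have "n \<notin> set j"
      using i y 3(3) by (fastforce simp: sublists_of_def)
    thus "i \<in> (Cons n) ` sublists_of L ?k \<union> sublists_of L (Suc ?k)"
      using i y by (auto simp: sublists_of_def)
  next
    fix i assume "i \<in> (Cons n) ` sublists_of L ?k \<union> sublists_of L (Suc ?k)"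
    thus "i \<in> sublists_of (n # L) (Suc ?k)"
      using 3(3) by (auto simp: sublists_of_def subset_iff)
  qed
  have disj: "(Cons n) ` sublists_of L ?k \<inter> sublists_of L (Suc ?k) = {}"
    using 3(3) by (auto simp: sublists_of_def)
  have cons: "mono_of (n # i) (x # a) = Poly_Mapping.single n x + mono_of i a" for i
    by (simp add: mono_of_def sum.lessThan_Suc_shift del: sum.lessThan_Suc)
  have "(\<Sum>i\<in>sublists_of (n # L) (Suc ?k). Poly_Mapping.single (mono_of i (x # a)) (1::nat))
      = (\<Sum>i\<in>sublists_of L ?k. Poly_Mapping.single (mono_of (n # i) (x # a)) 1)
        + (\<Sum>i\<in>sublists_of L (Suc ?k). Poly_Mapping.single (mono_of i (x # a)) 1)"
    unfolding split using finite_sublists_of disj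
    by (subst sum.union_disjoint) (auto simp: sum.reindex)
  also have "(\<Sum>i\<in>sublists_of L ?k. Poly_Mapping.single (mono_of (n # i) (x # a)) (1::nat))
      = Poly_Mapping.single (Poly_Mapping.single n x) 1
        * (\<Sum>i\<in>sublists_of L ?k. Poly_Mapping.single (mono_of i a) 1)"
    by (simp add: sum_distrib_left mult_single cons)
  finally show ?case using 3 by simp
qed

text \<open>With both factors written as sums of monomials, either side reduces to the double sum of
  1 over the pairs with \<open>p i + r j = m\<close>.\<close>

lemma lookup_mult_antidiagonal:
  fixes f g :: "xmono \<Rightarrow>\<^sub>0 nat"
  assumes "f = (\<Sum>i\<in>I. Poly_Mapping.single (p i) 1)" "g = (\<Sum>j\<in>J. Poly_Mapping.single (r j) 1)"
  shows "Poly_Mapping.lookup (f * g) m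
    = (\<Sum>(a, b)\<in>{(a, b). a + b = m}. Poly_Mapping.lookup f a * Poly_Mapping.lookup g b)"
proof -
  let ?D = "{(a, b). a + b = m}"
  have "(\<Sum>(a, b)\<in>?D. Poly_Mapping.lookup f a * Poly_Mapping.lookup g b)
      = (\<Sum>x\<in>?D. \<Sum>i\<in>I. \<Sum>j\<in>J. if x = (p i, r j) then 1 else 0)"
    by (intro sum.cong refl)
       (auto simp: assms lookup_sum lookup_single when_def sum_product intro!: sum.cong)
  also have "\<dots> = (\<Sum>i\<in>I. \<Sum>x\<in>?D. \<Sum>j\<in>J. if x = (p i, r j) then 1 else 0)"
    by (rule sum.swap)
  also have "\<dots> = (\<Sum>i\<in>I. \<Sum>j\<in>J. \<Sum>x\<in>?D. if x = (p i, r j) then 1 else 0)"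
    by (intro sum.cong refl sum.swap)
  also have "\<dots> = (\<Sum>i\<in>I. \<Sum>j\<in>J. if p i + r j = m then 1 else 0)"
    using finite_add_eq[of m] by (simp add: sum.delta)
  also have "\<dots> = Poly_Mapping.lookup (f * g) m"
    by (simp add: assms sum_product mult_single lookup_sum lookup_single when_def del: One_nat_def)
  finally show ?thesis ..
qed

text \<open>The coefficient of m in the monomial sum with all indices at most N.\<close>

definition trunc_count :: "nat \<Rightarrow> nat list \<Rightarrow> xmono \<Rightarrow> nat" where
  "trunc_count N a m = card {i \<in> idx_set (wd a) m. \<forall>x\<in>set i. x \<le> N}"

lemma trunc_count_eq: "trunc_count N a m = Poly_Mapping.lookup (trunc_qsym [1..<Suc N] a) m"
proof -
  let ?S = "sublists_of [1..<Suc N] (length a)"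
  have "trunc_qsym [1..<Suc N] a = (\<Sum>i\<in>?S. Poly_Mapping.single (mono_of i a) 1)"
    by (rule trunc_qsym_eq_sum) (rule sorted_wrt_upt)
  hence "Poly_Mapping.lookup (trunc_qsym [1..<Suc N] a) m = (\<Sum>i\<in>?S. if mono_of i a = m then 1 else 0)"
    by (simp add: lookup_sum lookup_single when_def del: One_nat_def upt_Suc)
  also have "\<dots> = card {i \<in> ?S. mono_of i a = m}"
    using finite_sublists_of by (simp add: sum.If_cases Int_def)
  also have "{i \<in> ?S. mono_of i a = m} = {i \<in> idx_set (wd a) m. \<forall>x\<in>set i. x \<le> N}"
    by (fastforce simp: sublists_of_def idx_set_def o_def less_Suc_eq_le Suc_le_eq)
  finally show ?thesis by (simp add: trunc_count_def)
qed

lemma trunc_count_mult: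
  "(\<Sum>(m1, m2)\<in>{(m1, m2). m1 + m2 = m}. trunc_count N a m1 * trunc_count N b m2)
    = (\<Sum>c\<in>#qsh a b. trunc_count N c m)"
proof -
  let ?L = "[1..<Suc N]"
  have L: "sorted_wrt (<) ?L" by (rule sorted_wrt_upt)
  have "(\<Sum>(m1, m2)\<in>{(m1, m2). m1 + m2 = m}. trunc_count N a m1 * trunc_count N b m2)
      = Poly_Mapping.lookup (trunc_qsym ?L a * trunc_qsym ?L b) m"
    unfolding trunc_count_eq
    by (subst lookup_mult_antidiagonal[OF trunc_qsym_eq_sum[OF L] trunc_qsym_eq_sum[OF L]]) (rule refl)
  also have "\<dots> = Poly_Mapping.lookup (\<Sum>c\<in>#qsh a b. trunc_qsym ?L c) m"
    by (simp only: trunc_qsym_mult)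
  also have "Poly_Mapping.lookup (\<Sum>c\<in>#C. trunc_qsym ?L c) m
      = (\<Sum>c\<in>#C. Poly_Mapping.lookup (trunc_qsym ?L c) m)" for C
    by (induction C) (simp_all add: lookup_add del: upt_Suc)
  finally show ?thesis by (simp only: trunc_count_eq)
qed

section \<open>Values at t = -N - 1/2 and the product formula\<close>

lemma card_incr_bounded: "card {j \<in> incr k n. \<forall>x\<in>set j. x \<le> N} = (N - n) choose k"
proof -
  have "bij_betw set {j \<in> incr k n. \<forall>x\<in>set j. x \<le> N} {S. S \<subseteq> {n<..N} \<and> card S = k}"
  proof (rule bij_betw_byWitness[where f' = sorted_list_of_set])
    show "\<forall>j\<in>{j \<in> incr k n. \<forall>x\<in>set j. x \<le> N}. sorted_list_of_set (set j) = j"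
      by (auto simp: incr_def strict_sorted_iff sorted_list_of_set.idem_if_sorted_distinct)
    have fin: "finite S" if "S \<subseteq> {n<..N}" for S
      using that finite_subset by blast
    show "\<forall>S\<in>{S. S \<subseteq> {n<..N} \<and> card S = k}. set (sorted_list_of_set S) = S"
      using fin by auto
    show "set ` {j \<in> incr k n. \<forall>x\<in>set j. x \<le> N} \<subseteq> {S. S \<subseteq> {n<..N} \<and> card S = k}"
      by (auto simp: incr_def strict_sorted_iff distinct_card)
    show "sorted_list_of_set ` {S. S \<subseteq> {n<..N} \<and> card S = k} \<subseteq> {j \<in> incr k n. \<forall>x\<in>set j. x \<le> N}"
      using fin by (auto simp: incr_def subset_iff)
  qed
  hence "card {j \<in> incr k n. \<forall>x\<in>set j. x \<le> N} = card {S. S \<subseteq> {n<..N} \<and> card S = k}"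
    by (rule bij_betw_same_card)
  thus ?thesis by (simp add: n_subsets)
qed

text \<open>At this t the upper argument -(t + n + 1/2) becomes N - n, and N - n choose k counts the
  admissible positions of the k trailing zeros after index n. The assumption on m keeps every prefix
  index, in particular n, at most N.\<close>

lemma poly_Mq:
  assumes "Poly_Mapping.keys m \<subseteq> {..N}"
  shows "poly (Mq a m) (- of_nat N - 1/2) = of_nat (trunc_count N a m)"
proof -
  obtain u k where a: "a = u @ replicate k 0" and u: "u = [] \<or> last u \<noteq> 0"
    by (rule split_trailing_zeros)
  let ?I = "idx_set (wd u) m"
  let ?B = "\<lambda>i. {j \<in> incr k (last0 i). \<forall>x\<in>set j. x \<le> N}"
  have last: "last0 i \<le> N" if "i \<in> ?I" for i
    using last0_idx_set[OF u that] assms by auto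
  have le: "x \<le> N" if "i \<in> ?I" "x \<in> set i" for i x
    using sorted_wrt_less_le_last[of i x] that last[of i]
    by (cases "i = []") (auto simp: idx_set_def last0_def)
  have "{i \<in> idx_set (wd a) m. \<forall>x\<in>set i. x \<le> N} = (\<lambda>(i, j). i @ j) ` Sigma ?I ?B"
    unfolding a idx_set_append_0 using le by (auto simp: image_iff)
  hence "trunc_count N a m = card (Sigma ?I ?B)"
    by (simp add: trunc_count_def card_image inj_on_idx_append)
  also have "\<dots> = (\<Sum>i\<in>?I. (N - last0 i) choose k)"
  proof -
    have "finite (?B i)" for i
      by (rule finite_subset[OF _ finite_lists_length_eq[of "{..N}" k]]) (auto simp: incr_def)
    thus ?thesis
      using finite_idx_set[OF u] by (subst card_SigmaI) (auto simp: card_incr_bounded)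
  qed
  finally have "of_nat (trunc_count N a m) = (\<Sum>i\<in>?I. of_nat ((N - last0 i) choose k) :: rat)"
    by simp
  also have "\<dots> = (\<Sum>i\<in>?I. (of_nat N - of_nat (last0 i)) gchoose k)"
    using last by (intro sum.cong refl) (simp add: binomial_gbinomial of_nat_diff)
  also have "\<dots> = poly (Mq a m) (- of_nat N - 1/2)"
    unfolding a Mq_eq[OF u] poly_sum poly_binp
    by (intro sum.cong refl arg_cong2[where f = "(gchoose)"]) (simp_all add: algebra_simps)
  finally show ?thesis ..
qed

lemma Mq_mult: "xmul (Mq a) (Mq b) m = (\<Sum>c\<in>#qsh a b. Mq c m)"
proof -
  let ?D = "{(m1, m2). m1 + m2 = m}"
  define N0 where "N0 = Max (insert 0 (Poly_Mapping.keys m))"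
  have poly_sum_mset: "poly (\<Sum>c\<in>#C. Mq c m) x = (\<Sum>c\<in>#C. poly (Mq c m) x)" for C x
    by (induction C) auto
  have eq: "poly (xmul (Mq a) (Mq b) m) (- of_nat N - 1/2)
      = poly (\<Sum>c\<in>#qsh a b. Mq c m) (- of_nat N - 1/2)" if "N \<ge> N0" for N
  proof -
    have keys: "Poly_Mapping.keys m \<subseteq> {..N}"
    proof
      fix x assume "x \<in> Poly_Mapping.keys m"
      hence "x \<le> N0" unfolding N0_def by (intro Max_ge) auto
      thus "x \<in> {..N}" using that by simp
    qed
    \<comment> \<open>Divisors of m involve only variables of m, so one bound N serves all terms of
      the convolution.\<close>
    have keys': "Poly_Mapping.keys m1 \<subseteq> {..N}" "Poly_Mapping.keys m2 \<subseteq> {..N}" if "m1 + m2 = m" for m1 m2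
    proof -
      have "Poly_Mapping.keys m1 \<subseteq> Poly_Mapping.keys m" "Poly_Mapping.keys m2 \<subseteq> Poly_Mapping.keys m"
        using that by (auto simp: in_keys_iff lookup_add)
      thus "Poly_Mapping.keys m1 \<subseteq> {..N}" "Poly_Mapping.keys m2 \<subseteq> {..N}"
        using keys by auto
    qed
    have "poly (xmul (Mq a) (Mq b) m) (- of_nat N - 1/2)
        = (\<Sum>(m1, m2)\<in>?D. of_nat (trunc_count N a m1 * trunc_count N b m2))"
      unfolding xmul_def poly_sum
      by (intro sum.cong refl) (auto simp: poly_Mq keys')
    also have "\<dots> = of_nat (\<Sum>(m1, m2)\<in>?D. trunc_count N a m1 * trunc_count N b m2)"
      by (simp add: case_prod_unfold)
    also have "\<dots> = of_nat (\<Sum>c\<in>#qsh a b. trunc_count N c m)"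
      by (simp only: trunc_count_mult)
    also have "of_nat (\<Sum>c\<in>#C. trunc_count N c m) = (\<Sum>c\<in>#C. of_nat (trunc_count N c m) :: rat)" for C
      by (induction C) auto
    also have "(\<Sum>c\<in>#qsh a b. of_nat (trunc_count N c m)) = poly (\<Sum>c\<in>#qsh a b. Mq c m) (- of_nat N - 1/2)"
      by (simp only: poly_sum_mset poly_Mq[OF keys])
    finally show ?thesis .
  qed
  have "infinite ((\<lambda>N. - of_nat N - 1/2 :: rat) ` {N0..})"
    using infinite_Ici[of N0] by (subst finite_image_iff) (auto simp: inj_on_def)
  moreover have "(\<lambda>N. - of_nat N - 1/2 :: rat) ` {N0..}
      \<subseteq> {x. poly (xmul (Mq a) (Mq b) m - (\<Sum>c\<in>#qsh a b. Mq c m)) x = 0}"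
    using eq by auto
  ultimately have "xmul (Mq a) (Mq b) m - (\<Sum>c\<in>#qsh a b. Mq c m) = 0"
    using poly_roots_finite finite_subset by blast
  thus ?thesis by simp
qed

section \<open>Extension of scalars\<close>

text \<open>Cross-multiplication shows that \<open>ratk q\<close> can be computed from any fraction
  representing q, independently of the reduced form and of the chosen inverse.\<close>

lemma ratk_mult_denominator:
  assumes inv: "\<And>n::nat. 0 < n \<Longrightarrow> (of_nat n :: 'k::comm_ring_1) dvd 1"
    and "b \<noteq> 0" "q * of_int b = of_int a"
  shows "(ratk q :: 'k) * of_int b = of_int a"
proof -
  obtain c d where cd: "quotient_of q = (c, d)" by (cases "quotient_of q")
  have d: "d > 0" "q = of_int c / of_int d"
    using cd quotient_of_denom_pos quotient_of_div by auto
  have "\<exists>y. of_int d * y = (1::'k)"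
    using inv[of "nat d"] d(1) by (auto simp: dvd_def intro: sym)
  hence y: "of_int d * (SOME y. of_int d * y = (1::'k)) = 1"
    by (rule someI_ex)
  have "of_int (c * b) = (of_int (a * d) :: rat)"
    using assms(3) d by (simp add: field_simps)
  hence "c * b = a * d" by (simp only: of_int_eq_iff)
  have "ratk q * of_int b = of_int (c * b) * (SOME y. of_int d * y = (1::'k))"
    by (simp add: ratk_def cd mult_ac)
  also have "\<dots> = of_int a"
    using y by (simp add: \<open>c * b = a * d\<close> mult.assoc)
  finally show ?thesis .
qed

text \<open>Each identity is checked after multiplying by a common denominator, which can be
  cancelled because positive integers are units.\<close>

lemma coeff_hom_ratk:
  assumes inv: "\<And>n::nat. 0 < n \<Longrightarrow> (of_nat n :: 'k::comm_ring_1) dvd 1"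
  shows "coeff_hom (ratk :: rat \<Rightarrow> 'k)"
proof
  have cancel: "x = y" if "x * of_int b = y * of_int b" "b > 0" for x y :: 'k and b
  proof -
    obtain z where z: "of_int b * z = (1::'k)"
      using inv[of "nat b"] \<open>b > 0\<close> by (auto simp: dvd_def)
    have "x = x * (of_int b * z)" "y = y * (of_int b * z)" by (simp_all add: z)
    thus ?thesis using that(1) by (metis mult.assoc)
  qed
  have frac: "\<exists>a b. b > 0 \<and> q * of_int b = of_int a" for q :: rat
  proof -
    obtain a b where ab: "quotient_of q = (a, b)" by (cases "quotient_of q")
    have "b > 0" "q = of_int a / of_int b"
      using quotient_of_denom_pos[OF ab] quotient_of_div[OF ab] by auto
    thus ?thesis by (intro exI[of _ a] exI[of _ b]) auto
  qed
  fix p q :: rat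
  obtain a b c d where pq: "b > 0" "p * of_int b = of_int a" "d > 0" "q * of_int d = of_int c"
    using frac[of p] frac[of q] by auto
  note R = ratk_mult_denominator[OF inv]
  have P: "ratk p * of_int b = (of_int a :: 'k)" and Q: "ratk q * of_int d = (of_int c :: 'k)"
    using pq by (auto intro!: R)
  have bd: "b * d > 0" using pq by simp
  have 1: "(p + q) * of_int (b * d) = of_int (a * d + c * b)"
    by (simp flip: pq(2,4) add: algebra_simps)
  have 2: "(p * q) * of_int (b * d) = of_int (a * c)"
    by (simp flip: pq(2,4))
  have "ratk (p + q) * of_int (b * d) = (of_int (a * d + c * b) :: 'k)"
    using bd 1 by (intro R) auto
  also have "\<dots> = (ratk p + ratk q) * of_int (b * d)"
    by (simp flip: P Q add: algebra_simps)
  finally show "ratk (p + q) = (ratk p + ratk q :: 'k)"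
    by (rule cancel) (rule bd)
  have "ratk (p * q) * of_int (b * d) = (of_int (a * c) :: 'k)"
    using bd 2 by (intro R) auto
  also have "\<dots> = (ratk p * ratk q) * of_int (b * d)"
    by (simp flip: P Q add: algebra_simps)
  finally show "ratk (p * q) = (ratk p * ratk q :: 'k)"
    by (rule cancel) (rule bd)
  show "ratk 1 = (1::'k)"
    using R[of 1 1 1] by simp
qed

lemma Mk_mult:
  assumes "\<And>n::nat. 0 < n \<Longrightarrow> (of_nat n :: 'k::comm_ring_1) dvd 1"
  shows "xmul (Mk a) (Mk b) m = (\<Sum>c\<in>#qsh a b. (Mk c m :: 'k poly))"
proof -
  interpret coeff_hom "map_poly (ratk :: rat \<Rightarrow> 'k)"
    by (rule coeff_hom.coeff_hom_map_poly[OF coeff_hom_ratk[OF assms]])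
  have "xmul (Mk a) (Mk b) m = map_poly (ratk :: rat \<Rightarrow> 'k) (xmul (Mq a) (Mq b) m)"
    by (simp add: xmul_def sum case_prod_unfold mult Mk_def)
  also have "\<dots> = map_poly ratk (\<Sum>c\<in>#qsh a b. Mq c m)"
    by (simp only: Mq_mult)
  also have "map_poly ratk (\<Sum>c\<in>#C. Mq c m) = (\<Sum>c\<in>#C. Mk c m :: 'k poly)" for C
    by (induction C) (auto simp: zero add Mk_def)
  finally show ?thesis .
qed

section \<open>Closure properties of \<open>RenQSym\<close>\<close>

lemma Mk_in_RenQSym: "(Mk a :: 'k::comm_ring_1 poly xser) \<in> RenQSym"
  unfolding RenQSym_def by (intro CollectI exI[of _ "{a}"] exI[of _ "\<lambda>_. 1"]) simp

lemma RenQSym_0: "(\<lambda>m. 0) \<in> (RenQSym :: 'k::comm_ring_1 poly xser set)"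
  unfolding RenQSym_def by (intro CollectI exI[of _ "{}"]) simp

lemma RenQSym_add:
  assumes "f \<in> RenQSym" "g \<in> (RenQSym :: 'k::comm_ring_1 poly xser set)"
  shows "(\<lambda>m. f m + g m) \<in> RenQSym"
proof -
  obtain S c where S: "finite S" "f = (\<lambda>m. \<Sum>a\<in>S. smult (c a) (Mk a m))"
    using assms(1) by (auto simp: RenQSym_def)
  obtain T d where T: "finite T" "g = (\<lambda>m. \<Sum>a\<in>T. smult (d a) (Mk a m))"
    using assms(2) by (auto simp: RenQSym_def)
  \<comment> \<open>Both combinations are extended by zero coefficients to the common index
    set.\<close>
  let ?c = "\<lambda>a. if a \<in> S then c a else 0" and ?d = "\<lambda>a. if a \<in> T then d a else 0"
  have "f m = (\<Sum>a\<in>S \<union> T. smult (?c a) (Mk a m))" for m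
    unfolding S(2) using S(1) T(1) by (intro sum.mono_neutral_cong_left) auto
  moreover have "g m = (\<Sum>a\<in>S \<union> T. smult (?d a) (Mk a m))" for m
    unfolding T(2) using S(1) T(1) by (intro sum.mono_neutral_cong_left) auto
  ultimately have "(\<lambda>m. f m + g m) = (\<lambda>m. \<Sum>a\<in>S \<union> T. smult (?c a + ?d a) (Mk a m))"
    by (simp add: sum.distrib smult_add_left)
  thus ?thesis
    unfolding RenQSym_def using S(1) T(1) by (intro CollectI exI[of _ "S \<union> T"]) auto
qed

lemma smult_sum_right: "smult x (sum f A) = (\<Sum>y\<in>A. smult x (f y))"
  by (induction A rule: infinite_finite_induct) (auto simp: smult_add_right)

lemma RenQSym_smult:
  assumes "f \<in> (RenQSym :: 'k::comm_ring_1 poly xser set)"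
  shows "(\<lambda>m. smult x (f m)) \<in> RenQSym"
proof -
  obtain S c where S: "finite S" "f = (\<lambda>m. \<Sum>a\<in>S. smult (c a) (Mk a m))"
    using assms by (auto simp: RenQSym_def)
  have "smult x (f m) = (\<Sum>a\<in>S. smult (x * c a) (Mk a m))" for m
    by (simp add: S(2) smult_sum_right)
  thus ?thesis
    unfolding RenQSym_def using S(1) by (intro CollectI exI[of _ S] exI[of _ "\<lambda>a. x * c a"]) simp
qed

lemma RenQSym_sum:
  assumes "\<And>x. x \<in> A \<Longrightarrow> F x \<in> (RenQSym :: 'k::comm_ring_1 poly xser set)"
  shows "(\<lambda>m. \<Sum>x\<in>A. F x m) \<in> RenQSym"
  using assms by (induction A rule: infinite_finite_induct) (auto intro: RenQSym_0 RenQSym_add)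

lemma RenQSym_mult:
  assumes inv: "\<And>n::nat. 0 < n \<Longrightarrow> (of_nat n :: 'k::comm_ring_1) dvd 1"
    and f: "f \<in> RenQSym" and g: "g \<in> (RenQSym :: 'k poly xser set)"
  shows "xmul f g \<in> RenQSym"
proof -
  obtain S c where S: "f = (\<lambda>m. \<Sum>a\<in>S. smult (c a) (Mk a m))"
    using f by (auto simp: RenQSym_def)
  obtain T d where T: "g = (\<lambda>m. \<Sum>a\<in>T. smult (d a) (Mk a m))"
    using g by (auto simp: RenQSym_def)
  have "xmul f g m = (\<Sum>a\<in>S. \<Sum>b\<in>T. smult (c a * d b) (xmul (Mk a) (Mk b) m))" for m
  proof -
    let ?D = "{(m1, m2). m1 + m2 = m}"
    have "xmul f g m = (\<Sum>x\<in>?D. \<Sum>a\<in>S. \<Sum>b\<in>T. smult (c a * d b) (Mk a (fst x) * Mk b (snd x)))"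
      by (simp add: xmul_def S T sum_product case_prod_unfold mult_ac)
    also have "\<dots> = (\<Sum>a\<in>S. \<Sum>x\<in>?D. \<Sum>b\<in>T. smult (c a * d b) (Mk a (fst x) * Mk b (snd x)))"
      by (rule sum.swap)
    also have "\<dots> = (\<Sum>a\<in>S. \<Sum>b\<in>T. \<Sum>x\<in>?D. smult (c a * d b) (Mk a (fst x) * Mk b (snd x)))"
      by (intro sum.cong refl sum.swap)
    also have "\<dots> = (\<Sum>a\<in>S. \<Sum>b\<in>T. smult (c a * d b) (xmul (Mk a) (Mk b) m))"
      by (simp add: xmul_def case_prod_unfold smult_sum_right)
    finally show ?thesis .
  qed
  moreover have "(\<lambda>m. xmul (Mk a) (Mk b) m) \<in> (RenQSym :: 'k poly xser set)" for a b
  proof -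
    have "(\<lambda>m. \<Sum>c\<in>#C. Mk c m) \<in> (RenQSym :: 'k poly xser set)" for C
      by (induction C) (auto intro: RenQSym_0 RenQSym_add Mk_in_RenQSym)
    thus ?thesis by (simp only: Mk_mult[OF inv])
  qed
  hence "(\<lambda>m. \<Sum>a\<in>S. \<Sum>b\<in>T. smult (c a * d b) (xmul (Mk a) (Mk b) m)) \<in> (RenQSym :: 'k poly xser set)"
    by (intro RenQSym_sum RenQSym_smult)
  ultimately show ?thesis by presburger
qed

text \<open>Only finitely many words occur in a combination, and each has a degree bound uniform in
  m.\<close>

lemma RenQSym_degree_bounded:
  assumes "f \<in> (RenQSym :: 'k::comm_ring_1 poly xser set)"
  shows "\<exists>N. \<forall>m. degree (f m) \<le> N"
proof -
  obtain S c where S: "finite S" "f = (\<lambda>m. \<Sum>a\<in>S. smult (c a) (Mk a m))"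
    using assms by (auto simp: RenQSym_def)
  have "degree (f m) \<le> (\<Sum>a\<in>S. length a)" for m
    unfolding S(2)
  proof (rule degree_sum_le)
    fix a assume "a \<in> S"
    have "degree (smult (c a) (Mk a m)) \<le> degree (Mk a m :: 'k poly)"
      by (rule degree_smult_le)
    also have "\<dots> \<le> degree (Mq a m)"
      unfolding Mk_def by (rule map_poly_degree_leq)
    also have "\<dots> \<le> length a"
      by (rule degree_Mq)
    also have "\<dots> \<le> (\<Sum>a\<in>S. length a)"
      using S(1) \<open>a \<in> S\<close> by (intro member_le_sum) auto
    finally show "degree (smult (c a) (Mk a m)) \<le> (\<Sum>a\<in>S. length a)" .
  qed (rule S(1))
  thus ?thesis by blast
qed

text \<open>That k contains Q is expressed by positive integers being units and 1 \<noteq> 0.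
  Membership in k[[X]][t] is expressed by a degree bound in t uniform over all monomials.\<close>

theorem theorem5p1:
  fixes \<alpha> \<beta> :: "nat list"
  assumes "\<And>n::nat. 0 < n \<Longrightarrow> (of_nat n :: 'k::comm_ring_1) dvd 1"
    and "(1::'k) \<noteq> 0"
  shows "xmul (Mk \<alpha>) (Mk \<beta>) = (\<lambda>m. \<Sum>\<gamma>\<in>#qsh \<alpha> \<beta>. (Mk \<gamma> m :: 'k poly))
    \<and> (RenQSym :: 'k poly xser set) \<subseteq> {f. \<exists>N. \<forall>m. degree (f m) \<le> N}
    \<and> xone \<in> (RenQSym :: 'k poly xser set)
    \<and> (\<forall>f\<in>(RenQSym :: 'k poly xser set). \<forall>g\<in>RenQSym.
          (\<lambda>m. f m + g m) \<in> RenQSym \<and> xmul f g \<in> RenQSym)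
    \<and> (\<forall>c f. f \<in> (RenQSym :: 'k poly xser set) \<longrightarrow> (\<lambda>m. smult c (f m)) \<in> RenQSym)"
proof -
  interpret coeff_hom "map_poly (ratk :: rat \<Rightarrow> 'k)"
    by (rule coeff_hom.coeff_hom_map_poly[OF coeff_hom_ratk[OF assms(1)]])
  have "Mk [] = (xone :: 'k poly xser)"
    by (auto simp: Mk_def Mq_def xone_def zero one)
  hence "xone \<in> (RenQSym :: 'k poly xser set)"
    using Mk_in_RenQSym[of "[]"] by metis
  thus ?thesis
    using Mk_mult[OF assms(1)] RenQSym_mult[OF assms(1)] RenQSym_degree_bounded
    by (auto intro: RenQSym_add RenQSym_smult)
qed

end
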